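(* Let $K$ be a field and $G$ a finite simple graph on $[n]$ such that $[n]$ is the disjoint union of those facets of the clique complex $\Delta(G)$ which have a free vertex. Then for every $k\ge1$ the power $I_G^k$ of the vertex cover ideal $I_G\subset K[x_1,\ldots,x_n]$ has a linear resolution.
   Context: The clique complex $\Delta(G)$ is the simplicial complex whose faces are the vertex sets of cliques (complete subgraphs) of $G$; its facets are the maximal cliques. A vertex of a facet $F$ is free if it belongs to no other facet. The vertex cover ideal is $I_G=\bigcap_{\{i,j\}\in E(G)}(x_i,x_j)$, equivalently generated by $\prod_{i\in C}x_i$ for $C$ a minimal vertex cover (a minimal set of vertices meeting every edge). An ideal has a linear resolution if it is generated in a single degree $d$ and its minimal graded free resolution has all differentials given by matrices of linear forms. *)

theory Defs
  imports Main "HOL-Library.Poly_Mapping"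
begin

text \<open>Multivariate polynomials over K: finitely supported maps from monomials
(exponent vectors nat =>0 nat) to coefficients; multiplication is convolution
(library instance comm_ring_1).\<close>

type_synonym 'a mpoly = "(nat \<Rightarrow>\<^sub>0 nat) \<Rightarrow>\<^sub>0 'a"

definition poly_ring :: "nat \<Rightarrow> 'a::field mpoly set" where
  "poly_ring n = {p :: 'a mpoly. \<forall>m\<in>Poly_Mapping.keys p. Poly_Mapping.keys m \<subseteq> {1..n}}"

definition mdeg :: "(nat \<Rightarrow>\<^sub>0 nat) \<Rightarrow> nat" where
  "mdeg m = (\<Sum>i\<in>Poly_Mapping.keys m. Poly_Mapping.lookup m i)"

text \<open>homogeneous of degree d (the zero polynomial is homogeneous of every degree)\<close>
definition homogeneous :: "nat \<Rightarrow> 'a::field mpoly \<Rightarrow> bool" where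
  "homogeneous d p \<longleftrightarrow> (\<forall>m\<in>Poly_Mapping.keys p. mdeg m = d)"

definition sqfree_monomial :: "nat set \<Rightarrow> 'a::field mpoly" where
  "sqfree_monomial C = Poly_Mapping.single (\<Sum>i\<in>C. Poly_Mapping.single i 1) 1"

definition ideal_gen :: "nat \<Rightarrow> 'a::field mpoly set \<Rightarrow> 'a mpoly set" where
  "ideal_gen n S = {(\<Sum>g\<in>F. c g * g) | F c. finite F \<and> F \<subseteq> S \<and> (\<forall>g\<in>F. c g \<in> poly_ring n)}"

definition ideal_mult :: "nat \<Rightarrow> 'a::field mpoly set \<Rightarrow> 'a mpoly set \<Rightarrow> 'a mpoly set" where
  "ideal_mult n I J = ideal_gen n {a * b | a b. a \<in> I \<and> b \<in> J}"

fun ideal_pow :: "nat \<Rightarrow> 'a::field mpoly set \<Rightarrow> nat \<Rightarrow> 'a mpoly set" where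
  "ideal_pow n I 0 = poly_ring n"
| "ideal_pow n I (Suc k) = ideal_mult n I (ideal_pow n I k)"

definition free_elem :: "nat \<Rightarrow> nat \<Rightarrow> (nat \<Rightarrow> 'a::field mpoly) \<Rightarrow> bool" where
  "free_elem n r v \<longleftrightarrow> (\<forall>j<r. v j \<in> poly_ring n) \<and> (\<forall>j\<ge>r. v j = 0)"

definition mat_app :: "(nat \<Rightarrow> nat \<Rightarrow> 'a::field mpoly) \<Rightarrow> nat \<Rightarrow> nat \<Rightarrow> (nat \<Rightarrow> 'a mpoly) \<Rightarrow> nat \<Rightarrow> 'a mpoly" where
  "mat_app A rows cols v = (\<lambda>i. if i < rows then (\<Sum>j<cols. A i j * v j) else 0)"

text \<open>An ideal I of K[x_1..x_n] has a linear resolution: there is d and a finite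
free resolution ... -> F_2 -> F_1 -> F_0 -> I -> 0 with F_i = R^(r i), the augmentation
F_0 -> I sending the basis to generators g_j homogeneous of degree d, and all the
differentials d_i : F_i -> F_(i-1) (i >= 1, matrix M i) given by matrices of linear forms.
(Such a resolution is automatically graded and minimal.)\<close>
definition has_linear_resolution :: "nat \<Rightarrow> 'a::field mpoly set \<Rightarrow> bool" where
  "has_linear_resolution n I \<longleftrightarrow>
    (\<exists>(d::nat) (r::nat \<Rightarrow> nat) (g::nat \<Rightarrow> 'a mpoly) (M::nat \<Rightarrow> nat \<Rightarrow> nat \<Rightarrow> 'a mpoly) (L::nat).
       (\<forall>i>L. r i = 0)
     \<and> (\<forall>j<r 0. g j \<in> poly_ring n \<and> homogeneous d (g j))
     \<and> I = {(\<Sum>j<r 0. g j * v j) | v. free_elem n (r 0) v}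
     \<and> (\<forall>i\<ge>1. \<forall>a<r (i - 1). \<forall>b<r i. M i a b \<in> poly_ring n \<and> homogeneous 1 (M i a b))
     \<and> (\<forall>v. free_elem n (r 0) v \<longrightarrow>
          ((\<Sum>j<r 0. g j * v j) = 0 \<longleftrightarrow>
           (\<exists>w. free_elem n (r 1) w \<and> v = mat_app (M 1) (r 0) (r 1) w)))
     \<and> (\<forall>i\<ge>1. \<forall>v. free_elem n (r i) v \<longrightarrow>
          (mat_app (M i) (r (i - 1)) (r i) v = (\<lambda>_. 0) \<longleftrightarrow>
           (\<exists>w. free_elem n (r (Suc i)) w \<and> v = mat_app (M (Suc i)) (r i) (r (Suc i)) w))))"

definition simple_graph_on :: "nat \<Rightarrow> (nat \<Rightarrow> nat \<Rightarrow> bool) \<Rightarrow> bool" where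
  "simple_graph_on n E \<longleftrightarrow> (\<forall>i j. E i j \<longrightarrow> E j i) \<and> (\<forall>i. \<not> E i i)
      \<and> (\<forall>i j. E i j \<longrightarrow> i \<in> {1..n} \<and> j \<in> {1..n})"

definition is_clique :: "nat \<Rightarrow> (nat \<Rightarrow> nat \<Rightarrow> bool) \<Rightarrow> nat set \<Rightarrow> bool" where
  "is_clique n E C \<longleftrightarrow> C \<subseteq> {1..n} \<and> (\<forall>i\<in>C. \<forall>j\<in>C. i \<noteq> j \<longrightarrow> E i j)"

definition is_facet :: "nat \<Rightarrow> (nat \<Rightarrow> nat \<Rightarrow> bool) \<Rightarrow> nat set \<Rightarrow> bool" where
  "is_facet n E F \<longleftrightarrow> is_clique n E F \<and> (\<forall>C. is_clique n E C \<and> F \<subseteq> C \<longrightarrow> C = F)"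

definition free_vertex :: "nat \<Rightarrow> (nat \<Rightarrow> nat \<Rightarrow> bool) \<Rightarrow> nat set \<Rightarrow> nat \<Rightarrow> bool" where
  "free_vertex n E F v \<longleftrightarrow> v \<in> F \<and> (\<forall>F'. is_facet n E F' \<and> v \<in> F' \<longrightarrow> F' = F)"

definition facets_with_free_vertex :: "nat \<Rightarrow> (nat \<Rightarrow> nat \<Rightarrow> bool) \<Rightarrow> nat set set" where
  "facets_with_free_vertex n E = {F. is_facet n E F \<and> (\<exists>v. free_vertex n E F v)}"

definition is_vertex_cover :: "nat \<Rightarrow> (nat \<Rightarrow> nat \<Rightarrow> bool) \<Rightarrow> nat set \<Rightarrow> bool" where
  "is_vertex_cover n E C \<longleftrightarrow> C \<subseteq> {1..n} \<and> (\<forall>i j. E i j \<longrightarrow> i \<in> C \<or> j \<in> C)"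

definition is_min_vertex_cover :: "nat \<Rightarrow> (nat \<Rightarrow> nat \<Rightarrow> bool) \<Rightarrow> nat set \<Rightarrow> bool" where
  "is_min_vertex_cover n E C \<longleftrightarrow> is_vertex_cover n E C \<and> (\<forall>D\<subset>C. \<not> is_vertex_cover n E D)"

definition vertex_cover_ideal :: "nat \<Rightarrow> (nat \<Rightarrow> nat \<Rightarrow> bool) \<Rightarrow> 'a::field mpoly set" where
  "vertex_cover_ideal n E = ideal_gen n {sqfree_monomial C | C. is_min_vertex_cover n E C}"

end

theory Submission
  imports Defs
begin

text \<open>Choose a free vertex in each of the disjoint facets and write \<open>v w\<close> for the one in the facet of
  \<open>w\<close>; let \<open>N\<close> be the set of vertices not chosen. A minimal vertex cover misses exactly one vertex of
  each facet, and a missed vertex \<open>t\<close> may always be traded for \<open>v t\<close>, whose neighbours all lie in its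
  facet. Hence the generators of the \<open>k\<close>-th power are the monomials
  \<open>\<Prod>w\<in>N. x_w^(k - b_w) x_(v w)^(b_w)\<close> with \<open>b\<close> in a finite set of exponents on \<open>N\<close> that is closed
  downwards. The unit cubes contained in such a set support a resolution whose differentials have
  entries \<open>0, \<plusminus>x_t, \<plusminus>x_(v t)\<close>. It is exact by induction on the set: removing a maximal \<open>b\<close> splits
  off the Koszul complex on the variables \<open>x_t\<close> with \<open>b_t > 0\<close>, which is the resolution of the colon ideal
  of the remaining generators by the generator of \<open>b\<close>.\<close>

abbreviation lookup where "lookup \<equiv> Poly_Mapping.lookup"
abbreviation keys where "keys \<equiv> Poly_Mapping.keys"
abbreviation single where "single \<equiv> Poly_Mapping.single"

section \<open>Polynomials and monomials\<close>

definition monom :: "(nat \<Rightarrow>\<^sub>0 nat) \<Rightarrow> 'a::field mpoly" where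
  "monom m = single m 1"

abbreviation var :: "nat \<Rightarrow> 'a::field mpoly" where
  "var t \<equiv> monom (single t 1)"

lemma monom_mult: "monom a * monom b = (monom (a + b) :: 'a::field mpoly)"
  by (simp add: monom_def mult_single)

lemma keys_monom [simp]: "keys (monom m :: 'a::field mpoly) = {m}"
  by (simp add: monom_def)

lemma monom_eq_iff [simp]: "monom a = (monom b :: 'a::field mpoly) \<longleftrightarrow> a = b"
  by (metis keys_monom singleton_inject)

lemma keys_add_nat: "keys (a + b :: nat \<Rightarrow>\<^sub>0 nat) = keys a \<union> keys b"
  by (auto simp: in_keys_iff lookup_add)

lemma lookup_monom_mult_add: "lookup (monom a * p) (a + m) = lookup (p :: 'a::field mpoly) m"
proof -
  have "lookup (monom a * p) (a + m) =
    (\<Sum>l. (1 when a = l) * (\<Sum>q. lookup p q when a + m = l + q))"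
    by (simp add: lookup_mult monom_def lookup_single)
  also have "\<dots> = (\<Sum>l. (\<Sum>q. lookup p q when a + m = l + q) when a = l)"
    by (simp add: when_mult)
  also have "\<dots> = (\<Sum>q. lookup p q when a + m = a + q)"
    by simp
  also have "\<dots> = (\<Sum>q. lookup p q when m = q)"
    by simp
  finally show ?thesis by simp
qed

lemma keys_monom_mult: "keys (monom a * p) = (+) a ` keys (p :: 'a::field mpoly)"
proof
  show "keys (monom a * p) \<subseteq> (+) a ` keys p"
    using keys_mult[of "monom a" p] by auto
  show "(+) a ` keys p \<subseteq> keys (monom a * p)"
    by (auto simp: in_keys_iff lookup_monom_mult_add)
qed

lemma mpoly_sum_keys: "(\<Sum>m\<in>keys p. single m (lookup p m)) = (p :: 'a::field mpoly)"
proof (rule poly_mapping_eqI)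
  fix k
  show "lookup (\<Sum>m\<in>keys p. single m (lookup p m)) k = lookup p k"
    by (cases "k \<in> keys p")
       (auto simp: lookup_sum lookup_single when_def sum.delta' in_keys_iff)
qed

section \<open>Closure properties of the polynomial ring, cancellation and division by
  variables\<close>

lemma poly_ring_0 [simp]: "0 \<in> poly_ring n"
  by (simp add: poly_ring_def)

lemma poly_ring_1 [simp]: "1 \<in> poly_ring n"
  by (simp add: poly_ring_def)

lemma poly_ring_add: "p \<in> poly_ring n \<Longrightarrow> q \<in> poly_ring n \<Longrightarrow> p + q \<in> poly_ring n"
  using keys_add[of p q] by (auto simp: poly_ring_def)

lemma poly_ring_uminus: "p \<in> poly_ring n \<Longrightarrow> - p \<in> poly_ring n"
  by (auto simp: poly_ring_def in_keys_iff)

lemma poly_ring_diff: "p \<in> poly_ring n \<Longrightarrow> q \<in> poly_ring n \<Longrightarrow> p - q \<in> poly_ring n"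
  using poly_ring_add[OF _ poly_ring_uminus, of p n q] by simp

lemma poly_ring_mult: "p \<in> poly_ring n \<Longrightarrow> q \<in> poly_ring n \<Longrightarrow> p * q \<in> poly_ring n"
  using keys_mult[of p q] by (fastforce simp: poly_ring_def keys_add_nat)

lemma poly_ring_sum: "(\<And>i. i \<in> I \<Longrightarrow> f i \<in> poly_ring n) \<Longrightarrow> sum f I \<in> poly_ring n"
  by (induction I rule: infinite_finite_induct) (auto intro: poly_ring_add)

lemma poly_ring_monom: "keys m \<subseteq> {1..n} \<Longrightarrow> monom m \<in> poly_ring n"
  by (simp add: poly_ring_def)

lemma poly_ring_var: "t \<in> {1..n} \<Longrightarrow> var t \<in> poly_ring n"
  by (simp add: poly_ring_monom)

text \<open>Multiplication by a monomial only translates the support, so each term of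
  \<open>monom a * p\<close> survives until some other summand cancels it. This is how membership in
  colon ideals of monomial ideals is tested below.\<close>

lemma keys_cancel_term:
  fixes p :: "'a::field mpoly"
  assumes "monom a * p + (\<Sum>b\<in>B. monom (h b) * q b) = 0" and "m \<in> keys p"
  obtains b m' where "b \<in> B" "a + m = h b + m'"
proof -
  have "monom a * p = - (\<Sum>b\<in>B. monom (h b) * q b)"
    using assms(1) by (simp add: eq_neg_iff_add_eq_0)
  moreover have "a + m \<in> keys (monom a * p)"
    using assms(2) by (simp add: keys_monom_mult)
  ultimately have "a + m \<in> keys (\<Sum>b\<in>B. monom (h b) * q b)"
    by (simp add: in_keys_iff)
  then obtain b where "b \<in> B" "a + m \<in> keys (monom (h b) * q b)"
    using keys_sum[of "\<lambda>b. monom (h b) * q b" B] by auto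
  thus ?thesis
    using that by (auto simp: keys_monom_mult)
qed

text \<open>For each term one variable \<open>c m\<close> of \<open>S\<close> dividing it is chosen.
  Grouping the terms by this choice and dividing gives the coefficients \<open>q s\<close>; the
  subtraction \<open>m - single s 1\<close> does not truncate because \<open>c m\<close> lies in the
  support of \<open>m\<close>.\<close>

lemma variable_ideal_decomposition:
  fixes p :: "'a::field mpoly"
  assumes "finite S" and "p \<in> poly_ring n" and "\<And>m. m \<in> keys p \<Longrightarrow> keys m \<inter> S \<noteq> {}"
  obtains q where "\<And>s. q s \<in> poly_ring n" and "p = (\<Sum>s\<in>S. var s * q s)"
proof -
  obtain c where c: "\<And>m. m \<in> keys p \<Longrightarrow> c m \<in> keys m \<inter> S"
    using bchoice[of "keys p" "\<lambda>m s. s \<in> keys m \<inter> S"] assms(3) by blast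
  define q where "q s = (\<Sum>m\<in>{m \<in> keys p. c m = s}. single (m - single s 1) (lookup p m))" for s
  have split: "single (c m) 1 + (m - single (c m) 1) = m" if "m \<in> keys p" for m
    using c[OF that]
    by (intro poly_mapping_eqI)
       (auto simp: lookup_add lookup_minus lookup_single when_def in_keys_iff)
  have "q s \<in> poly_ring n" for s
    unfolding q_def
  proof (rule poly_ring_sum, clarsimp)
    fix m assume "m \<in> keys p"
    hence "keys m \<subseteq> {1..n}" using assms(2) by (simp add: poly_ring_def)
    moreover have "keys (m - single (c m) 1) \<subseteq> keys m"
      by (auto simp: in_keys_iff lookup_minus)
    ultimately show "single (m - single (c m) (Suc 0)) (lookup p m) \<in> poly_ring n"
      by (auto simp: poly_ring_def)
  qed
  moreover have "(\<Sum>s\<in>S. var s * q s) = p"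
  proof -
    have "(\<Sum>s\<in>S. var s * q s) = (\<Sum>s\<in>S. \<Sum>m\<in>{m \<in> keys p. c m = s}. single m (lookup p m))"
      unfolding q_def sum_distrib_left
      by (intro sum.cong refl) (auto simp: monom_def mult_single split[simplified])
    also have "\<dots> = (\<Sum>m\<in>keys p. single m (lookup p m))"
      by (rule sum.group) (use assms(1) c in auto)
    finally show ?thesis by (simp add: mpoly_sum_keys)
  qed
  ultimately show ?thesis using that by metis
qed

section \<open>Homogeneity and total degree\<close>

lemma homogeneous_0 [simp]: "homogeneous d 0"
  by (simp add: homogeneous_def)

lemma homogeneous_uminus: "homogeneous d p \<Longrightarrow> homogeneous d (- p)"
  by (auto simp: homogeneous_def in_keys_iff)

lemma homogeneous_diff: "homogeneous d p \<Longrightarrow> homogeneous d q \<Longrightarrow> homogeneous d (p - q)"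
  by (auto simp: homogeneous_def in_keys_iff lookup_minus)

lemma homogeneous_sum: "(\<And>i. i \<in> I \<Longrightarrow> homogeneous d (f i)) \<Longrightarrow> homogeneous d (sum f I)"
  using keys_sum[of f I] unfolding homogeneous_def by fastforce

lemma homogeneous_var: "homogeneous 1 (var t)"
  by (simp add: homogeneous_def mdeg_def)

lemma mdeg_add: "mdeg (a + b) = mdeg a + mdeg b"
proof -
  have "mdeg a = (\<Sum>i\<in>keys a \<union> keys b. lookup a i)" for a b
    unfolding mdeg_def by (intro sum.mono_neutral_left) (auto simp: in_keys_iff)
  from this[of a b] this[of b a] show ?thesis
    by (simp add: mdeg_def keys_add_nat lookup_add sum.distrib Un_commute)
qed

lemma mdeg_single [simp]: "mdeg (single t k) = k"
  by (simp add: mdeg_def)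

lemma mdeg_sum: "mdeg (sum f I) = (\<Sum>i\<in>I. mdeg (f i))"
  by (induction I rule: infinite_finite_induct) (simp_all add: mdeg_add, simp_all add: mdeg_def)

section \<open>The Koszul complex on a set of variables\<close>

text \<open>The incidence sign of the face \<open>A\<close> in \<open>insert t A\<close> when
  simplices are oriented by increasing vertices.\<close>

definition koszul_sign :: "nat \<Rightarrow> nat set \<Rightarrow> 'a::field mpoly" where
  "koszul_sign t A = (if even (card {s \<in> A. s < t}) then 1 else - 1)"

lemma koszul_sign_insert:
  assumes "t \<notin> A"
  shows "koszul_sign s (insert t A) = (if t < s then - koszul_sign s A else koszul_sign s A)"
proof -
  have "{x \<in> insert t A. x < s} = (if t < s then insert t {x \<in> A. x < s} else {x \<in> A. x < s})"
    by auto
  moreover have "finite {x \<in> A. x < s}"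
    by (rule finite_subset[of _ "{..<s}"]) auto
  ultimately show ?thesis
    using assms by (simp add: koszul_sign_def)
qed

lemma koszul_sign_eqs: "koszul_sign t A * p = p \<or> koszul_sign t A * p = - p"
  by (simp add: koszul_sign_def)

lemma koszul_sign_poly_ring: "p \<in> poly_ring n \<Longrightarrow> koszul_sign t A * p \<in> poly_ring n"
  using koszul_sign_eqs[of t A p] poly_ring_uminus[of p n] by auto

lemma koszul_sign_homogeneous: "homogeneous d p \<Longrightarrow> homogeneous d (koszul_sign t A * p)"
  using koszul_sign_eqs[of t A p] homogeneous_uminus[of d p] by auto

text \<open>Induction on \<open>D\<close>: a new element adds one row and one column, which cancel
  pairwise. Swapping the two summations would give only that twice the sum vanishes, which says
  nothing in characteristic 2.\<close>

lemma sum_alternating: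
  fixes f :: "'b \<Rightarrow> 'b \<Rightarrow> 'c::ab_group_add"
  assumes "finite D" and "\<And>s t. s \<in> D \<Longrightarrow> t \<in> D \<Longrightarrow> s \<noteq> t \<Longrightarrow> f t s + f s t = 0"
  shows "(\<Sum>t\<in>D. \<Sum>s\<in>D - {t}. f t s) = 0"
  using assms
proof (induction D rule: finite_induct)
  case (insert a D)
  have "(\<Sum>s\<in>insert a D - {t}. f t s) = f t a + (\<Sum>s\<in>D - {t}. f t s)" if "t \<in> D" for t
  proof -
    have "insert a D - {t} = insert a (D - {t})" using insert that by auto
    thus ?thesis using insert by simp
  qed
  hence "(\<Sum>t\<in>insert a D. \<Sum>s\<in>insert a D - {t}. f t s)
    = (\<Sum>s\<in>D. f a s) + ((\<Sum>t\<in>D. f t a) + (\<Sum>t\<in>D. \<Sum>s\<in>D - {t}. f t s))"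
    using insert by (simp add: sum.distrib)
  also have "\<dots> = (\<Sum>s\<in>D. f a s + f s a)"
    using insert by (simp add: sum.distrib)
  also have "\<dots> = 0"
    by (intro sum.neutral ballI insert.prems) (use insert in auto)
  finally show ?case .
qed simp

text \<open>Adding \<open>s\<close> and \<open>t\<close> in the other order changes exactly one of
  the two signs, while \<open>Q\<close> is symmetric. This one cancellation makes both the Koszul
  and the cubical differential square to zero.\<close>

lemma koszul_sign_alternating:
  fixes Q :: "nat \<Rightarrow> nat \<Rightarrow> 'a::field mpoly"
  assumes "finite S" and "\<And>s t. Q s t = Q t s"
  shows "(\<Sum>t\<in>S - A. koszul_sign t A *
    (\<Sum>s\<in>S - insert t A. koszul_sign s (insert t A) * Q t s)) = 0"
proof -
  have "(\<Sum>t\<in>S - A. \<Sum>s\<in>S - A - {t}. koszul_sign t A * (koszul_sign s (insert t A) * Q t s)) = 0"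
  proof (rule sum_alternating)
    fix s t assume "s \<in> S - A" "t \<in> S - A" "s \<noteq> t"
    thus "koszul_sign t A * (koszul_sign s (insert t A) * Q t s) +
        koszul_sign s A * (koszul_sign t (insert s A) * Q s t) = 0"
      using assms(2)[of s t] by (simp add: koszul_sign_insert algebra_simps)
  qed (use assms in simp)
  moreover have "S - insert t A = S - A - {t}" for t by auto
  ultimately show ?thesis by (simp add: sum_distrib_left)
qed

text \<open>The Koszul differential in coordinates: \<open>y A\<close> is the coefficient of the
  basis element e_A, and the coefficient of the image at \<open>A\<close> collects what the elements
  with one more index send there.\<close>

definition koszul :: "nat set \<Rightarrow> (nat set \<Rightarrow> 'a::field mpoly) \<Rightarrow> nat set \<Rightarrow> 'a mpoly" where
  "koszul S y A = (\<Sum>t\<in>S - A. koszul_sign t A * (var t * y (insert t A)))"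

definition koszul_chain :: "nat \<Rightarrow> nat set \<Rightarrow> nat \<Rightarrow> (nat set \<Rightarrow> 'a::field mpoly) \<Rightarrow> bool" where
  "koszul_chain n S i y \<longleftrightarrow> (\<forall>A. y A \<in> poly_ring n) \<and> (\<forall>A. \<not> (A \<subseteq> S \<and> card A = i) \<longrightarrow> y A = 0)"

lemma koszul_koszul: "finite S \<Longrightarrow> koszul S (koszul S y) A = 0"
proof -
  assume S: "finite S"
  have "koszul S (koszul S y) A = (\<Sum>t\<in>S - A. koszul_sign t A *
    (\<Sum>s\<in>S - insert t A. koszul_sign s (insert t A) * (var t * var s * y (insert s (insert t A)))))"
    unfolding koszul_def sum_distrib_left by (intro sum.cong refl) (simp only: ac_simps)
  also have "\<dots> = 0"
    by (rule koszul_sign_alternating[OF S]) (simp add: ac_simps insert_commute)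
  finally show ?thesis .
qed

lemma koszul_diff: "koszul S (\<lambda>A. y A - z A) A = koszul S y A - koszul S z A"
  by (simp add: koszul_def right_diff_distrib sum_subtractf)

lemma koszul_add: "koszul S (\<lambda>A. y A + z A) A = koszul S y A + koszul S z A"
  by (simp add: koszul_def distrib_left sum.distrib)

text \<open>In degree 0 the cycle condition becomes membership of \<open>y {}\<close> in the ideal
  generated by the variables of \<open>S\<close>, expressed on supports. A decomposition of
  \<open>y {}\<close> along these variables, placed on the singletons, is the required
  preimage.\<close>

lemma koszul_exact_0:
  fixes y :: "nat set \<Rightarrow> 'a::field mpoly"
  assumes "finite S" "koszul_chain n S 0 y" "\<And>m. m \<in> keys (y {}) \<Longrightarrow> keys m \<inter> S \<noteq> {}"
  obtains w where "koszul_chain n S (Suc 0) w" "koszul S w = y"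
proof -
  have "y {} \<in> poly_ring n" using assms(2) by (simp add: koszul_chain_def)
  from variable_ideal_decomposition[OF assms(1) this assms(3)]
  obtain q where q: "\<And>s. q s \<in> poly_ring n" "y {} = (\<Sum>s\<in>S. var s * q s)" by blast
  define w where "w A = (if \<exists>s\<in>S. A = {s} then q (the_elem A) else 0)" for A
  have "koszul_chain n S (Suc 0) w"
    using q(1) by (auto simp: koszul_chain_def w_def)
  moreover have "koszul S w A = y A" for A
  proof (cases "A = {}")
    case True
    thus ?thesis by (simp add: koszul_def q(2) w_def koszul_sign_def cong: sum.cong)
  next
    case False
    have "w (insert t A) = 0" if "t \<in> S - A" for t
      using False that by (auto simp: w_def)
    hence "koszul S w A = 0" by (simp add: koszul_def)
    moreover have "y A = 0"
      using False assms(1,2) unfolding koszul_chain_def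
      by (metis card_eq_0_iff finite_subset)
    ultimately show ?thesis by simp
  qed
  ultimately show ?thesis using that by blast
qed

section \<open>Exactness of the Koszul complex in positive degrees\<close>

lemma koszul_chain_nonzero:
  assumes "koszul_chain n S i y" "y A \<noteq> 0"
  shows "A \<subseteq> S" "card A = i"
  using assms unfolding koszul_chain_def by blast+

lemma koszul_chain_koszul:
  assumes "finite S" "S \<subseteq> {1..n}" "koszul_chain n S (Suc i) y"
  shows "koszul_chain n S i (koszul S y)"
  unfolding koszul_chain_def
proof (intro conjI allI impI)
  fix A
  show "koszul S y A \<in> poly_ring n"
    unfolding koszul_def using assms(2,3)
    by (intro poly_ring_sum koszul_sign_poly_ring poly_ring_mult poly_ring_var)
       (auto simp: koszul_chain_def)
  assume A: "\<not> (A \<subseteq> S \<and> card A = i)"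
  have "y (insert t A) = 0" if "t \<in> S - A" for t
  proof (rule ccontr)
    assume "y (insert t A) \<noteq> 0"
    hence "insert t A \<subseteq> S" "card (insert t A) = Suc i"
      using koszul_chain_nonzero[OF assms(3)] by blast+
    thus False using A that assms(1) finite_subset by fastforce
  qed
  thus "koszul S y A = 0" by (simp add: koszul_def)
qed

lemma koszul_superset:
  assumes "finite T" "S \<subseteq> T" "\<And>A. \<not> A \<subseteq> S \<Longrightarrow> y A = 0"
  shows "koszul T y A = koszul S y A"
proof -
  have "y (insert t A) = 0" if "t \<notin> S" for t
    using assms(3) that by blast
  thus ?thesis
    unfolding koszul_def using assms(1,2) by (intro sum.mono_neutral_right) auto
qed

text \<open>Splits off the part of a chain that involves e_t and strips e_t from it.\<close>

lemma koszul_chain_insert_cases: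
  assumes "finite S" "t \<notin> S" "koszul_chain n (insert t S) (Suc i) y"
  shows "koszul_chain n S i (\<lambda>A. if t \<in> A then 0 else y (insert t A))"
proof -
  have "y (insert t A) = 0" if "\<not> (A \<subseteq> S \<and> card A = i)" "t \<notin> A" for A
  proof (rule ccontr)
    assume "y (insert t A) \<noteq> 0"
    hence "insert t A \<subseteq> insert t S" "card (insert t A) = Suc i"
      using koszul_chain_nonzero[OF assms(3)] by blast+
    moreover from this have "A \<subseteq> S" using that by auto
    ultimately show False using that finite_subset[OF _ assms(1)] by auto
  qed
  thus ?thesis using assms(3) by (auto simp: koszul_chain_def)
qed

text \<open>The Koszul complex on \<open>insert t S\<close> is the mapping cone of multiplication by
  x_t on the one on \<open>S\<close>. The e_t-part \<open>y1\<close> of a cycle is a cycle on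
  \<open>S\<close>, hence a boundary; lifting its preimage removes all of \<open>y\<close> that
  involves \<open>t\<close>, and what remains is a cycle on \<open>S\<close>. In the lowest degree
  \<open>y1\<close> bounds because x_t is a nonzerodivisor modulo the variables of
  \<open>S\<close>.\<close>

lemma koszul_exact:
  fixes y :: "nat set \<Rightarrow> 'a::field mpoly"
  assumes "finite S" "S \<subseteq> {1..n}" "koszul_chain n S (Suc i) y" "\<And>A. koszul S y A = 0"
  shows "\<exists>w. koszul_chain n S (Suc (Suc i)) w \<and> koszul S w = y"
  using assms
proof (induction S arbitrary: i y rule: finite_linorder_max_induct)
  case empty
  hence "y A = 0" for A by (cases "A = {}") (auto simp: koszul_chain_def)
  hence "y = (\<lambda>_. 0)" by auto
  thus ?case
    by (intro exI[of _ "\<lambda>_. 0"]) (auto simp: koszul_chain_def koszul_def)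
next
  case (insert t S)
  have t: "t \<notin> S" using insert by auto
  let ?T = "insert t S"
  define y1 where "y1 A = (if t \<in> A then 0 else y (insert t A))" for A
  have y1: "koszul_chain n S i y1"
    unfolding y1_def by (rule koszul_chain_insert_cases) (use insert t in auto)
  \<comment> \<open>Since \<open>t\<close> exceeds every element of \<open>S\<close>, its presence
    in \<open>A\<close> does not affect the signs of the remaining directions.\<close>
  have top: "koszul ?T u A = koszul S (\<lambda>A. u (insert t A)) (A - {t})"
    if "t \<in> A" for u :: "nat set \<Rightarrow> 'a mpoly" and A
  proof -
    have set: "?T - A = S - (A - {t})" using t that by auto
    have "koszul_sign s A * (var s * u (insert s A)) =
        koszul_sign s (A - {t}) * (var s * u (insert t (insert s (A - {t}))))"
      if s: "s \<in> S - (A - {t})" for s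
    proof -
      have "koszul_sign s A = (koszul_sign s (A - {t}) :: 'a mpoly)"
      proof -
        have "s < t" using insert(2) s by auto
        thus ?thesis
          using koszul_sign_insert[of t "A - {t}" s] \<open>t \<in> A\<close> by (simp add: insert_absorb)
      qed
      moreover have "insert t (insert s (A - {t})) = insert s A" using \<open>t \<in> A\<close> by auto
      ultimately show ?thesis by (simp only:)
    qed
    thus ?thesis unfolding koszul_def set by (rule sum.cong[OF refl])
  qed
  have "koszul S y1 A = 0" for A
  proof (cases "t \<in> A")
    case False
    have "koszul S y1 A = koszul S (\<lambda>A. y (insert t A)) A"
      unfolding koszul_def y1_def using False t by (intro sum.cong) auto
    also have "\<dots> = koszul ?T y (insert t A)"
      using top[of "insert t A" y] False by simp
    finally show ?thesis using insert.prems by simp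
  qed (simp add: y1_def koszul_def)
  have "\<exists>w. koszul_chain n S (Suc i) w \<and> koszul S w = y1"
  proof (cases i)
    case 0
    \<comment> \<open>The term x_t times \<open>m\<close> must cancel against a multiple of some x_s
      with \<open>s \<in> S\<close>; as \<open>s\<close> differs from \<open>t\<close>, already
      \<open>m\<close> is divisible by x_s.\<close>
    have "keys m \<inter> S \<noteq> {}" if m: "m \<in> keys (y1 {})" for m
    proof -
      have "0 = koszul ?T y {}" using insert.prems by simp
      also have "\<dots> = var t * y {t} + (\<Sum>s\<in>S. var s * y {s})"
        using insert(1) t by (simp add: koszul_def koszul_sign_def)
      finally have "var t * y1 {} + (\<Sum>s\<in>S. var s * y {s}) = 0" by (simp add: y1_def)
      from keys_cancel_term[OF this m]
      obtain s m' where s: "s \<in> S" "single t 1 + m = single s 1 + m'" .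
      hence "lookup (single t 1 + m) s = lookup (single s 1 + m') s" by simp
      hence "s \<in> keys m"
        using s(1) t by (auto simp: lookup_add lookup_single when_def in_keys_iff split: if_splits)
      thus ?thesis using s by auto
    qed
    moreover have "koszul_chain n S 0 y1" using y1 0 by simp
    ultimately obtain w where "koszul_chain n S (Suc 0) w" "koszul S w = y1"
      using koszul_exact_0[OF insert(1)] by blast
    thus ?thesis using 0 by blast
  next
    case (Suc j)
    thus ?thesis using insert(3)[of j y1] y1 insert.prems \<open>\<And>A. koszul S y1 A = 0\<close> by auto
  qed
  then obtain w1 where w1: "koszul_chain n S (Suc i) w1" "koszul S w1 = y1" by blast
  \<comment> \<open>\<open>W\<close> is e_t times \<open>w1\<close>. Its image agrees with
    \<open>y\<close> on all sets containing \<open>t\<close>, so the difference \<open>y'\<close>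
    lives on subsets of \<open>S\<close>.\<close>
  define W where "W A = (if t \<in> A then w1 (A - {t}) else 0)" for A
  have W: "koszul_chain n ?T (Suc (Suc i)) W"
  proof -
    have "W A = 0" if "\<not> (A \<subseteq> ?T \<and> card A = Suc (Suc i))" for A
    proof (rule ccontr)
      assume "W A \<noteq> 0"
      hence "t \<in> A" and 1: "A - {t} \<subseteq> S" "card (A - {t}) = Suc i"
        using koszul_chain_nonzero[OF w1(1)] by (auto simp: W_def split: if_splits)
      from 1 have "finite (A - {t})" using insert(1) finite_subset by blast
      hence "card A = Suc (Suc i)" using 1 \<open>t \<in> A\<close> by (metis card.remove finite_insert insert_Diff)
      thus False using that 1 by auto
    qed
    thus ?thesis using w1(1) by (simp add: koszul_chain_def W_def)
  qed
  define y' where "y' A = y A - koszul ?T W A" for A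
  have y'_t: "y' A = 0" if "t \<in> A" for A
  proof -
    have "koszul ?T W A = koszul S (\<lambda>A. W (insert t A)) (A - {t})" using top that .
    also have "\<dots> = koszul S w1 (A - {t})"
    proof -
      have "W (insert t (insert s (A - {t}))) = w1 (insert s (A - {t}))" if "s \<in> S" for s
        using t that by (auto simp: W_def intro!: arg_cong[of _ _ w1])
      thus ?thesis unfolding koszul_def by (intro sum.cong) auto
    qed
    also have "\<dots> = y A" using that w1(2) by (simp add: y1_def insert_absorb)
    finally show ?thesis by (simp add: y'_def)
  qed
  have cut: "koszul ?T u A = koszul S u A" if "\<And>A. t \<in> A \<Longrightarrow> u A = 0"
    for u :: "nat set \<Rightarrow> 'a mpoly" and A
    unfolding koszul_def
    by (rule sum.mono_neutral_right) (use that insert(1) in auto)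
  have "koszul_chain n ?T (Suc i) (koszul ?T W)"
    by (rule koszul_chain_koszul) (use insert W in auto)
  note KW = this
  have "A \<subseteq> S \<and> card A = Suc i" if "y' A \<noteq> 0" for A
  proof -
    have "t \<notin> A" using y'_t that by blast
    moreover have "y A \<noteq> 0 \<or> koszul ?T W A \<noteq> 0" using that by (auto simp: y'_def)
    hence "A \<subseteq> ?T \<and> card A = Suc i"
      using koszul_chain_nonzero[OF KW] koszul_chain_nonzero[OF insert.prems(2)] by blast
    ultimately show ?thesis by (simp add: subset_insert)
  qed
  moreover have "y' A \<in> poly_ring n" for A
    using insert.prems(2) KW unfolding koszul_chain_def y'_def by (intro poly_ring_diff) blast+
  ultimately have "koszul_chain n S (Suc i) y'"
    unfolding koszul_chain_def by blast
  moreover have "koszul S y' A = 0" for A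
    using cut[of y' A] y'_t insert.prems(3) koszul_koszul[of ?T W A] insert(1)
    by (simp add: koszul_diff[of ?T y "koszul ?T W", folded y'_def])
  ultimately obtain w2 where w2: "koszul_chain n S (Suc (Suc i)) w2" "koszul S w2 = y'"
    using insert(3)[of i y'] insert.prems by auto
  have "koszul ?T w2 = y'"
  proof
    fix A
    have "w2 C = 0" if "t \<in> C" for C
      using koszul_chain_nonzero(1)[OF w2(1)] t that by blast
    from cut[OF this] show "koszul ?T w2 A = y' A" by (simp add: w2(2))
  qed
  hence "koszul ?T (\<lambda>A. W A + w2 A) = y"
    by (simp add: fun_eq_iff koszul_add y'_def)
  moreover have "koszul_chain n ?T (Suc (Suc i)) (\<lambda>A. W A + w2 A)"
    using W w2(1) by (auto simp: koszul_chain_def intro: poly_ring_add)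
  ultimately show ?case by blast
qed

section \<open>The cubical resolution attached to a box of exponents\<close>

type_synonym cell = "(nat \<Rightarrow>\<^sub>0 nat) \<times> nat set"

lemma mdeg_eq_0_iff [simp]: "mdeg m = 0 \<longleftrightarrow> m = 0"
  by (auto simp: mdeg_def sum_eq_0_iff in_keys_iff intro: poly_mapping_eqI)

definition pointwise_le :: "(nat \<Rightarrow>\<^sub>0 nat) \<Rightarrow> (nat \<Rightarrow>\<^sub>0 nat) \<Rightarrow> bool" where
  "pointwise_le a b \<longleftrightarrow> (\<forall>w. lookup a w \<le> lookup b w)"

text \<open>An element of largest total degree is maximal: anything pointwise above it differs by an
  exponent of degree 0.\<close>

lemma ex_pointwise_maximal:
  assumes "finite B" "B \<noteq> {}"
  obtains b0 where "b0 \<in> B" "\<And>b. b \<in> B \<Longrightarrow> pointwise_le b0 b \<Longrightarrow> b = b0"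
proof -
  have "Max (mdeg ` B) \<in> mdeg ` B" using assms by (intro Max_in) auto
  then obtain b0 where b0: "b0 \<in> B" "mdeg b0 = Max (mdeg ` B)" by auto
  have "b = b0" if "b \<in> B" "pointwise_le b0 b" for b
  proof -
    have b: "b = b0 + (b - b0)"
      using that(2) by (intro poly_mapping_eqI) (simp add: lookup_add lookup_minus pointwise_le_def)
    hence "mdeg b = mdeg b0 + mdeg (b - b0)" by (metis mdeg_add)
    moreover have "mdeg b \<le> mdeg b0" using b0(2) that(1) assms(1) by simp
    ultimately have "b - b0 = 0" by (metis add_le_same_cancel1 le_zero_eq mdeg_eq_0_iff)
    thus ?thesis using b by simp
  qed
  thus ?thesis using that b0(1) by blast
qed

text \<open>Stated for unit steps, the moves from a cube to its bottom faces.\<close>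

definition down_closed :: "nat set \<Rightarrow> (nat \<Rightarrow>\<^sub>0 nat) set \<Rightarrow> bool" where
  "down_closed N B \<longleftrightarrow> (\<forall>b. \<forall>t\<in>N. b + single t 1 \<in> B \<longrightarrow> b \<in> B)"

text \<open>The map \<open>v\<close> need not be injective: all vertices of \<open>N\<close> in one
  facet share a value. What is kept is that the values lie outside \<open>N\<close>, so the
  exponents of a generator at \<open>N\<close> can be read off without interference.\<close>

locale exponent_box =
  fixes n k :: nat and N :: "nat set" and v :: "nat \<Rightarrow> nat"
  assumes N: "N \<subseteq> {1..n}" and v: "v ` N \<subseteq> {1..n} - N"
begin

lemma finite_N [simp]: "finite N"
  using N finite_subset by blast

lemma v_notin [simp]: "w \<in> N \<Longrightarrow> v w \<notin> N"
  using v by auto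

definition box :: "(nat \<Rightarrow>\<^sub>0 nat) set \<Rightarrow> bool" where
  "box B \<longleftrightarrow> finite B \<and> down_closed N B \<and> (\<forall>b\<in>B. keys b \<subseteq> N \<and> (\<forall>w. lookup b w \<le> k))"

text \<open>Exponent of the generator \<open>\<Prod>w\<in>N. x_w^(k - b_w) x_(v w)^(b_w)\<close>; in a box of bound
  \<open>k\<close> the subtraction does not truncate.\<close>

definition gexp :: "(nat \<Rightarrow>\<^sub>0 nat) \<Rightarrow> (nat \<Rightarrow>\<^sub>0 nat)" where
  "gexp b = (\<Sum>w\<in>N. single w (k - lookup b w) + single (v w) (lookup b w))"

lemma lookup_gexp: "t \<in> N \<Longrightarrow> lookup (gexp b) t = k - lookup b t"
proof -
  assume t: "t \<in> N"
  have "lookup (gexp b) t = (\<Sum>w\<in>N. if w = t then k - lookup b t else 0)"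
    unfolding gexp_def lookup_sum
  proof (intro sum.cong refl)
    fix w assume "w \<in> N"
    hence "v w \<noteq> t" using t v_notin by metis
    thus "lookup (single w (k - lookup b w) + single (v w) (lookup b w)) t =
        (if w = t then k - lookup b t else 0)"
      by (auto simp: lookup_add lookup_single when_def)
  qed
  thus ?thesis using t by simp
qed

lemma keys_gexp: "keys (gexp b) \<subseteq> {1..n}"
  unfolding gexp_def
  by (rule order_trans[OF keys_sum]) (use N v in \<open>auto simp: keys_add_nat split: if_splits\<close>)

text \<open>The linear relation between the generators at the two ends of an edge of the box: x_t
  times one equals x_(v t) times the other. The bound on \<open>lookup b t\<close> keeps
  \<open>k - (lookup b t + 1)\<close> from truncating.\<close>

lemma gexp_shift:
  assumes "t \<in> N" "lookup b t < k"
  shows "single t 1 + gexp (b + single t 1) = single (v t) 1 + gexp b"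
proof -
  have eq: "gexp c = (single t (k - lookup c t) + single (v t) (lookup c t)) +
      (\<Sum>w\<in>N - {t}. single w (k - lookup c w) + single (v w) (lookup c w))" for c
    unfolding gexp_def using assms(1) by (simp add: sum.remove)
  have "(\<Sum>w\<in>N - {t}. single w (k - lookup (b + single t 1) w) + single (v w) (lookup (b + single t 1) w))
      = (\<Sum>w\<in>N - {t}. single w (k - lookup b w) + single (v w) (lookup b w))"
    by (intro sum.cong) (auto simp: lookup_add lookup_single when_def)
  moreover have "single t 1 + (single t (k - (lookup b t + 1)) + single (v t) (lookup b t + 1))
      = single (v t) 1 + (single t (k - lookup b t) + single (v t) (lookup b t))"
    using assms(2) by (intro poly_mapping_eqI) (auto simp: lookup_add lookup_single when_def)
  ultimately show ?thesis
    unfolding eq[of b] eq[of "b + single t 1"]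
    by (simp add: lookup_add add.assoc[symmetric])
qed

lemma mdeg_gexp:
  assumes "\<And>w. lookup b w \<le> k"
  shows "mdeg (gexp b) = k * card N"
proof -
  have "mdeg (gexp b) = (\<Sum>w\<in>N. k)"
    unfolding gexp_def mdeg_sum by (intro sum.cong) (simp_all add: mdeg_add assms)
  thus ?thesis by simp
qed

lemma gexp_inj:
  assumes "keys b \<subseteq> N" "keys c \<subseteq> N" "\<And>w. lookup b w \<le> k" "\<And>w. lookup c w \<le> k" "gexp b = gexp c"
  shows "b = c"
proof (rule poly_mapping_eqI)
  fix w
  show "lookup b w = lookup c w"
  proof (cases "w \<in> N")
    case True
    hence "k - lookup b w = k - lookup c w" using assms(5) lookup_gexp by metis
    thus ?thesis using assms(3)[of w] assms(4)[of w] by linarith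
  next
    case False
    hence "w \<notin> keys b" "w \<notin> keys c" using assms(1,2) by auto
    thus ?thesis by (simp add: in_keys_iff)
  qed
qed

text \<open>The cell \<open>(b, A)\<close> is the cube with top vertex \<open>b\<close> spanned by the directions in \<open>A\<close>; its
  vertices are \<open>b\<close> minus the indicator vectors of the subsets of \<open>A\<close>. The differential below is
  written on coefficients: it collects at \<open>(b, A)\<close> the contributions of the cubes of one dimension
  more having \<open>(b, A)\<close> as bottom or top face in direction \<open>t\<close>.\<close>

definition cells :: "(nat \<Rightarrow>\<^sub>0 nat) set \<Rightarrow> nat \<Rightarrow> cell set" where
  "cells B i = {(b, A). b \<in> B \<and> A \<subseteq> keys b \<and> card A = i}"

definition chain :: "(nat \<Rightarrow>\<^sub>0 nat) set \<Rightarrow> nat \<Rightarrow> (cell \<Rightarrow> 'a::field mpoly) \<Rightarrow> bool" where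
  "chain B i z \<longleftrightarrow> (\<forall>c. z c \<in> poly_ring n) \<and> (\<forall>c. c \<notin> cells B i \<longrightarrow> z c = 0)"

definition bd :: "(cell \<Rightarrow> 'a::field mpoly) \<Rightarrow> cell \<Rightarrow> 'a mpoly" where
  "bd z c = (\<Sum>t\<in>N - snd c. koszul_sign t (snd c) *
     (var (v t) * z (fst c + single t 1, insert t (snd c)) - var t * z (fst c, insert t (snd c))))"

definition augment :: "(nat \<Rightarrow>\<^sub>0 nat) set \<Rightarrow> (cell \<Rightarrow> 'a::field mpoly) \<Rightarrow> 'a mpoly" where
  "augment B z = (\<Sum>b\<in>B. monom (gexp b) * z (b, {}))"

text \<open>In degree 0 a cycle is a syzygy of the generators, so that exactness at the augmentation
  and in higher degrees is proved by a single induction.\<close>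

definition cycle :: "(nat \<Rightarrow>\<^sub>0 nat) set \<Rightarrow> nat \<Rightarrow> (cell \<Rightarrow> 'a::field mpoly) \<Rightarrow> bool" where
  "cycle B i z \<longleftrightarrow> chain B i z \<and> (if i = 0 then augment B z = 0 else (\<forall>c. bd z c = 0))"

section \<open>The cubical complex and its exactness\<close>

lemma chain_nonzero:
  assumes "chain B i z" "z (b, A) \<noteq> 0"
  shows "b \<in> B" "A \<subseteq> keys b" "card A = i"
proof -
  have "(b, A) \<in> cells B i" using assms unfolding chain_def by blast
  thus "b \<in> B" "A \<subseteq> keys b" "card A = i" by (auto simp: cells_def)
qed

text \<open>Taking faces in directions \<open>t\<close> and \<open>s\<close> commutes, coefficients
  included, so the combined coefficient \<open>Q\<close> is symmetric and the signs cancel the terms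
  in pairs.\<close>

lemma bd_bd: "bd (bd z) c = 0"
proof -
  obtain b A where c: "c = (b, A)" by force
  define Q where "Q t s = var (v t) * (var (v s) * z (b + single t 1 + single s 1, insert s (insert t A)))
     - var (v t) * (var s * z (b + single t 1, insert s (insert t A)))
     - var t * (var (v s) * z (b + single s 1, insert s (insert t A)))
     + var t * (var s * z (b, insert s (insert t A)))" for t s
  have "bd (bd z) c = (\<Sum>t\<in>N - A. koszul_sign t A *
      (\<Sum>s\<in>N - insert t A. koszul_sign s (insert t A) * Q t s))"
    unfolding c bd_def Q_def fst_conv snd_conv sum_distrib_left sum_subtractf[symmetric]
    by (intro sum.cong refl) (simp add: algebra_simps)
  also have "\<dots> = 0"
    by (rule koszul_sign_alternating) (simp_all add: Q_def insert_commute algebra_simps)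
  finally show ?thesis .
qed

lemma bd_add: "bd (\<lambda>c. y c + z c) c = bd y c + bd z c"
  unfolding bd_def sum.distrib[symmetric] by (intro sum.cong) (simp_all add: algebra_simps)

lemma bd_diff: "bd (\<lambda>c. y c - z c) c = bd y c - bd z c"
  unfolding bd_def sum_subtractf[symmetric] by (intro sum.cong) (simp_all add: algebra_simps)

text \<open>Down-closure keeps the bottom faces inside the box. Lowering the top vertex in direction
  \<open>t\<close> leaves \<open>A\<close> inside its support because \<open>t\<close> is not in
  \<open>A\<close>.\<close>

lemma chain_bd:
  assumes "box B" "chain B (Suc i) z"
  shows "chain B i (bd z)"
  unfolding chain_def
proof (intro conjI allI impI)
  fix c :: cell
  show "bd z c \<in> poly_ring n"
    unfolding bd_def using assms(2) N v
    by (intro poly_ring_sum koszul_sign_poly_ring poly_ring_diff poly_ring_mult poly_ring_var)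
       (auto simp: chain_def)
  assume c: "c \<notin> cells B i"
  obtain b A where bA: "c = (b, A)" by force
  have "z (b', insert t A) = 0" if "t \<in> N - A" "b' = b \<or> b' = b + single t 1" for t b'
  proof (rule ccontr)
    assume "z (b', insert t A) \<noteq> 0"
    note 1 = chain_nonzero[OF assms(2) this]
    have "b \<in> B" using 1(1) that assms(1) by (auto simp: box_def down_closed_def)
    moreover have "A \<subseteq> keys b"
    proof
      fix s assume "s \<in> A"
      with that 1(2) show "s \<in> keys b" by (auto simp: keys_add_nat split: if_splits)
    qed
    moreover have "card A = i"
      using 1 that by (metis DiffD2 card_insert_disjoint diff_Suc_1 finite_insert finite_keys finite_subset)
    ultimately show False using c bA by (simp add: cells_def)
  qed
  thus "bd z c = 0" by (simp add: bd_def bA)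
qed

text \<open>For each direction \<open>t\<close> the contributions of bottom and top endpoints of
  edges agree: \<open>gexp_shift\<close> equates the terms, and the translation by
  \<open>single t 1\<close> matches the endpoints.\<close>

lemma augment_bd:
  assumes "box B" "chain B (Suc 0) z"
  shows "augment B (bd z) = 0"
proof -
  have "finite B" using assms(1) by (simp add: box_def)
  have eq: "(\<Sum>b\<in>B. monom (gexp b) * (var (v t) * z (b + single t 1, {t})))
          = (\<Sum>b\<in>B. monom (gexp b) * (var t * z (b, {t})))" if t: "t \<in> N" for t
  proof -
    let ?C = "{b \<in> B. b + single t 1 \<in> B}"
    have inj: "inj_on (\<lambda>b. b + single t 1) ?C" by (rule inj_onI) simp
    have "(\<Sum>b\<in>B. monom (gexp b) * (var (v t) * z (b + single t 1, {t})))
        = (\<Sum>b\<in>?C. monom (gexp b) * (var (v t) * z (b + single t 1, {t})))"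
      using \<open>finite B\<close> chain_nonzero(1)[OF assms(2)]
      by (intro sum.mono_neutral_right) auto
    also have "\<dots> = (\<Sum>b\<in>?C. monom (gexp (b + single t 1)) * (var t * z (b + single t 1, {t})))"
    proof (intro sum.cong refl)
      fix b assume "b \<in> ?C"
      hence "lookup (b + single t 1) t \<le> k" using assms(1) by (auto simp: box_def)
      hence "single t 1 + gexp (b + single t 1) = single (v t) 1 + gexp b"
        by (intro gexp_shift t) (simp add: lookup_add)
      hence e: "var t * monom (gexp (b + single t 1)) = (var (v t) * monom (gexp b) :: 'a mpoly)"
        unfolding monom_mult by (rule arg_cong)
      from arg_cong[OF e, of "\<lambda>p. p * z (b + single t 1, {t})"]
      show "monom (gexp b) * (var (v t) * z (b + single t 1, {t})) =
            monom (gexp (b + single t 1)) * (var t * z (b + single t 1, {t}))"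
        by (simp only: ac_simps)
    qed
    also have "\<dots> = (\<Sum>b\<in>(\<lambda>b. b + single t 1) ` ?C. monom (gexp b) * (var t * z (b, {t})))"
      by (subst sum.reindex[OF inj]) (simp add: o_def)
    \<comment> \<open>If an edge ends at \<open>b\<close> in direction \<open>t\<close>, then
      \<open>t\<close> is in the support of \<open>b\<close>, and down-closure supplies its lower
      endpoint; all other \<open>b\<close> contribute 0.\<close>
    also have "\<dots> = (\<Sum>b\<in>B. monom (gexp b) * (var t * z (b, {t})))"
    proof (intro sum.mono_neutral_left ballI \<open>finite B\<close>)
      fix b assume b: "b \<in> B - (\<lambda>b. b + single t 1) ` ?C"
      have "z (b, {t}) = 0"
      proof (rule ccontr)
        assume "z (b, {t}) \<noteq> 0"
        hence "t \<in> keys b" using chain_nonzero(2)[OF assms(2)] by blast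
        define c where "c = b - single t 1"
        have "b = c + single t 1"
          using \<open>t \<in> keys b\<close> unfolding c_def by (intro poly_mapping_eqI)
             (auto simp: lookup_add lookup_minus lookup_single when_def in_keys_iff)
        moreover have "c \<in> B"
          using calculation assms(1) b t by (auto simp: box_def down_closed_def)
        ultimately have "b \<in> (\<lambda>b. b + single t 1) ` ?C" using b by blast
        thus False using b by blast
      qed
      thus "monom (gexp b) * (var t * z (b, {t})) = 0" by simp
    qed auto
    finally show ?thesis .
  qed
  have "augment B (bd z) = (\<Sum>b\<in>B. \<Sum>t\<in>N. monom (gexp b) * (var (v t) * z (b + single t 1, {t}))
      - monom (gexp b) * (var t * z (b, {t})))"
    by (simp add: augment_def bd_def sum_distrib_left right_diff_distrib koszul_sign_def)
  also have "\<dots> = (\<Sum>t\<in>N. \<Sum>b\<in>B. monom (gexp b) * (var (v t) * z (b + single t 1, {t}))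
      - monom (gexp b) * (var t * z (b, {t})))"
    by (rule sum.swap)
  also have "\<dots> = 0"
    by (rule sum.neutral, rule ballI) (simp only: sum_subtractf eq diff_self)
  finally show ?thesis .
qed

text \<open>The cells with top vertex a maximal exponent \<open>b0\<close> form, modulo the rest, a Koszul complex.\<close>

lemma bd_at_maximal:
  assumes "chain B i z" "b0 \<in> B" "keys b0 \<subseteq> N" "\<And>b. b \<in> B \<Longrightarrow> pointwise_le b0 b \<Longrightarrow> b = b0"
  shows "bd z (b0, A) = - koszul (keys b0) (\<lambda>A. z (b0, A)) A"
proof -
  have "z (b0 + single t 1, C) = 0" for t C
  proof (rule ccontr)
    assume "z (b0 + single t 1, C) \<noteq> 0"
    hence "b0 + single t 1 \<in> B" using chain_nonzero[OF assms(1)] by blast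
    hence "b0 + single t 1 = b0"
      by (intro assms(4)) (auto simp: pointwise_le_def lookup_add)
    thus False by (metis add_cancel_right_right keys_eq_empty keys_single insert_not_empty one_neq_zero keys_zero)
  qed
  hence "bd z (b0, A) = - koszul N (\<lambda>A. z (b0, A)) A"
    by (simp add: bd_def koszul_def sum_negf)
  also have "koszul N (\<lambda>A. z (b0, A)) A = koszul (keys b0) (\<lambda>A. z (b0, A)) A"
    using chain_nonzero(2)[OF assms(1)] assms(3) by (intro koszul_superset) auto
  finally show ?thesis .
qed

text \<open>In positive degree the slice of \<open>z\<close> at \<open>b0\<close> is a Koszul cycle
  by \<open>bd_at_maximal\<close>. In degree 0 it has to lie in the ideal of the variables in
  \<open>keys b0\<close>: a term \<open>m\<close> avoiding these would be cancelled through another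
  generator dividing \<open>gexp b0 + m\<close>. Comparing exponents on \<open>keys b0\<close> puts
  its \<open>b\<close> pointwise above \<open>b0\<close>, against maximality.\<close>

lemma cycle_at_maximal:
  fixes z :: "cell \<Rightarrow> 'a::field mpoly"
  assumes B: "box B" and z: "cycle B i z" and b0: "b0 \<in> B"
    and max: "\<And>b. b \<in> B \<Longrightarrow> pointwise_le b0 b \<Longrightarrow> b = b0"
  shows "\<exists>y. koszul_chain n (keys b0) (Suc i) y \<and> koszul (keys b0) y = (\<lambda>A. z (b0, A))"
proof -
  have keys: "keys b0 \<subseteq> N" using B b0 by (auto simp: box_def)
  have ch: "chain B i z" using z by (simp add: cycle_def)
  have K: "koszul_chain n (keys b0) i (\<lambda>A. z (b0, A))"
    using ch chain_nonzero(2,3)[OF ch] unfolding koszul_chain_def chain_def by blast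
  show ?thesis
  proof (cases i)
    case 0
    have "keys m \<inter> keys b0 \<noteq> {}" if m: "m \<in> keys (z (b0, {}))" for m
    proof
      assume disj: "keys m \<inter> keys b0 = {}"
      have "monom (gexp b0) * z (b0, {}) + (\<Sum>b\<in>B - {b0}. monom (gexp b) * z (b, {})) = 0"
        using z 0 B b0 by (simp add: cycle_def augment_def box_def sum.remove)
      then obtain b m' where b: "b \<in> B - {b0}" "gexp b0 + m = gexp b + m'"
        by (rule keys_cancel_term[OF _ m])
      have "lookup b0 w \<le> lookup b w" for w
      proof (cases "w \<in> keys b0")
        case True
        hence "w \<in> N" "lookup m w = 0" using keys disj by (auto simp: in_keys_iff)
        hence "k - lookup b0 w = k - lookup b w + lookup m' w"
          using arg_cong[OF b(2), of "\<lambda>p. lookup p w"] by (simp add: lookup_add lookup_gexp)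
        \<comment> \<open>A bound at \<open>b0\<close> suffices here: were
          \<open>k - lookup b w\<close> truncated, \<open>lookup b w\<close> would exceed
          \<open>k\<close> anyway.\<close>
        moreover have "lookup b0 w \<le> k" using B b0 by (auto simp: box_def)
        ultimately show ?thesis by linarith
      qed (simp add: in_keys_iff)
      hence "b = b0" using b(1) max[of b] unfolding pointwise_le_def by blast
      thus False using b(1) by simp
    qed
    thus ?thesis using koszul_exact_0[of "keys b0" n "\<lambda>A. z (b0, A)"] K 0 by (metis finite_keys)
  next
    case (Suc j)
    have "koszul (keys b0) (\<lambda>A. z (b0, A)) A = 0" for A
      using z bd_at_maximal[OF ch b0 keys max, of A] Suc by (simp add: cycle_def)
    thus ?thesis
      using koszul_exact[of "keys b0" n j "\<lambda>A. z (b0, A)"] K keys N unfolding Suc by auto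
  qed
qed

lemma cycle_bd:
  assumes "box B" "chain B (Suc i) w"
  shows "cycle B i (bd w)"
  using assms by (cases i) (simp_all add: cycle_def chain_bd augment_bd bd_bd)

text \<open>A maximal \<open>b0\<close> is peeled off: a Koszul preimage of the slice at
  \<open>b0\<close>, extended by zero, has a boundary agreeing with \<open>z\<close> there. The
  difference is a cycle on the smaller box \<open>B - {b0}\<close>.\<close>

lemma exactness:
  assumes "box B" "cycle B i z"
  shows "\<exists>w. chain B (Suc i) w \<and> bd w = z"
  using assms
proof (induction "card B" arbitrary: B z)
  case 0
  hence "B = {}" by (auto simp: box_def)
  hence "z = (\<lambda>_. 0)" using 0 by (auto simp: cycle_def chain_def cells_def)
  thus ?case
    by (intro exI[of _ "\<lambda>_. 0"]) (auto simp: chain_def bd_def)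
next
  case (Suc m)
  note B = \<open>box B\<close> and z = \<open>cycle B i z\<close>
  have fin: "finite B" using B by (simp add: box_def)
  moreover have "B \<noteq> {}" using Suc by auto
  ultimately obtain b0 where b0: "b0 \<in> B" and max: "\<And>b. b \<in> B \<Longrightarrow> pointwise_le b0 b \<Longrightarrow> b = b0"
    using ex_pointwise_maximal by metis
  have keys: "keys b0 \<subseteq> N" using B b0 by (auto simp: box_def)
  obtain y where y: "koszul_chain n (keys b0) (Suc i) y" "koszul (keys b0) y = (\<lambda>A. z (b0, A))"
    using cycle_at_maximal[OF B z b0 max] by blast
  \<comment> \<open>The minus sign offsets the one in \<open>bd_at_maximal\<close>, which comes from
    the coefficient \<open>- var t\<close> of top faces.\<close>
  define w0 where "w0 c = (if fst c = b0 then - y (snd c) else 0)" for c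
  have w0: "chain B (Suc i) w0"
    using y(1) b0 by (auto simp: chain_def w0_def cells_def koszul_chain_def poly_ring_uminus)
  define z' where "z' c = z c - bd w0 c" for c
  have cyc: "cycle B i (bd w0)" by (rule cycle_bd[OF B w0])
  have z'_cycle: "cycle B i z'"
    using z cyc
    by (auto simp: cycle_def chain_def z'_def[abs_def] poly_ring_diff bd_diff augment_def
          right_diff_distrib sum_subtractf)
  have z'_top: "z' (b0, A) = 0" for A
  proof -
    have "bd w0 (b0, A) = - koszul (keys b0) (\<lambda>A. - y A) A"
      using bd_at_maximal[OF w0 b0 keys max, of A] by (simp add: w0_def)
    also have "\<dots> = koszul (keys b0) y A"
      by (simp add: koszul_def sum_negf)
    finally show ?thesis by (simp add: z'_def y(2))
  qed
  let ?B = "B - {b0}"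
  \<comment> \<open>Removing an element from a down-closed set keeps it down-closed only if nothing
    lies above it, which is the maximality of \<open>b0\<close>.\<close>
  have B': "box ?B"
  proof -
    have "b \<noteq> b0" if "t \<in> N" "b + single t 1 \<in> ?B" for b t
      using that max[of "b + single t 1"] by (auto simp: pointwise_le_def lookup_add)
    thus ?thesis using B by (auto simp: box_def down_closed_def)
  qed
  have "augment ?B z' = augment B z'"
    unfolding augment_def using fin z'_top by (intro sum.mono_neutral_left) auto
  moreover have "chain ?B i z'"
    unfolding chain_def
  proof (intro conjI allI impI)
    have ch: "chain B i z'" using z'_cycle by (simp add: cycle_def)
    show "z' c \<in> poly_ring n" for c using ch unfolding chain_def by blast
    show "z' c = 0" if "c \<notin> cells ?B i" for c
      using that z'_top chain_nonzero[OF ch, of "fst c" "snd c"]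
      by (cases c) (auto simp: cells_def)
  qed
  ultimately have "cycle ?B i z'"
    using z'_cycle by (simp add: cycle_def)
  moreover have "m = card ?B" using Suc(2) b0 fin by simp
  ultimately obtain w1 where w1: "chain ?B (Suc i) w1" "bd w1 = z'"
    using Suc(1)[OF _ B'] by blast
  have "chain B (Suc i) (\<lambda>c. w0 c + w1 c)"
    using w0 w1(1) by (auto simp: chain_def cells_def intro: poly_ring_add)
  moreover have "bd (\<lambda>c. w0 c + w1 c) = z"
    by (auto simp: bd_add w1(2) z'_def)
  ultimately show ?case by blast
qed

lemma exactness_iff:
  assumes "box B" "chain B i z"
  shows "(if i = 0 then augment B z = 0 else bd z = (\<lambda>_. 0)) \<longleftrightarrow> (\<exists>w. chain B (Suc i) w \<and> bd w = z)"
proof -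
  have "cycle B i z \<longleftrightarrow> (\<exists>w. chain B (Suc i) w \<and> bd w = z)"
    using exactness[OF assms(1)] cycle_bd[OF assms(1)] by blast
  moreover have "bd z = (\<lambda>_. 0) \<longleftrightarrow> (\<forall>c. bd z c = 0)" by (rule fun_eq_iff)
  ultimately show ?thesis using assms(2) unfolding cycle_def by (simp only: simp_thms)
qed

section \<open>Matrix entries of the cubical differential\<close>

definition bd_coeff :: "cell \<Rightarrow> cell \<Rightarrow> 'a::field mpoly" where
  "bd_coeff c c' = bd (\<lambda>x. if x = c' then 1 else 0) c"

lemma bd_coeff_poly_ring: "bd_coeff c c' \<in> poly_ring n"
  unfolding bd_coeff_def bd_def using N v
  by (intro poly_ring_sum koszul_sign_poly_ring poly_ring_diff poly_ring_mult poly_ring_var) auto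

lemma bd_coeff_homogeneous: "homogeneous 1 (bd_coeff c c')"
proof -
  have "homogeneous 1 (var t * (if P then 1 else 0 :: 'a mpoly))" for t P
    using homogeneous_var[of t] by (cases P) simp_all
  thus ?thesis
    unfolding bd_coeff_def bd_def
    by (intro homogeneous_sum koszul_sign_homogeneous homogeneous_diff)
qed

lemma bd_scale: "bd (\<lambda>c. f c * a) c = bd f c * a"
  unfolding bd_def sum_distrib_right by (intro sum.cong) (simp_all add: algebra_simps)

lemma bd_sum: "finite I \<Longrightarrow> bd (\<lambda>c. \<Sum>i\<in>I. f i c) c = (\<Sum>i\<in>I. bd (f i) c)"
proof (induction I rule: finite_induct)
  case empty
  show ?case by (simp add: bd_def)
qed (simp add: bd_add)

lemma finite_cells:
  assumes "box B" shows "finite (cells B i)"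
proof (rule finite_subset)
  show "cells B i \<subseteq> B \<times> Pow N" using assms by (auto simp: cells_def box_def)
  show "finite (B \<times> Pow N)" using assms by (auto simp: box_def)
qed

text \<open>A chain is a finite combination of indicator functions of cells, and \<open>bd\<close>
  is linear; hence its values on indicators form its matrix.\<close>

lemma bd_expand:
  fixes z :: "cell \<Rightarrow> 'a::field mpoly"
  assumes "box B" "chain B i z"
  shows "bd z c = (\<Sum>c'\<in>cells B i. bd_coeff c c' * z c')"
proof -
  have "z = (\<lambda>x. \<Sum>c'\<in>cells B i. (if x = c' then 1 else 0) * z c')"
  proof
    fix x
    have "(\<Sum>c'\<in>cells B i. (if x = c' then 1 else 0) * z c') = (\<Sum>c'\<in>cells B i. if x = c' then z c' else 0)"
      by (intro sum.cong) auto
    also have "\<dots> = (if x \<in> cells B i then z x else 0)"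
      using finite_cells[OF assms(1)] by (simp add: sum.delta')
    also have "\<dots> = z x"
      using assms(2) unfolding chain_def by (metis (full_types))
    finally show "z x = (\<Sum>c'\<in>cells B i. (if x = c' then 1 else 0) * z c')" ..
  qed
  hence "bd z c = bd (\<lambda>x. \<Sum>c'\<in>cells B i. (if x = c' then 1 else 0) * z c') c"
    by simp
  also have "\<dots> = (\<Sum>c'\<in>cells B i. bd_coeff c c' * z c')"
    unfolding bd_sum[OF finite_cells[OF assms(1)]] bd_scale bd_coeff_def ..
  finally show ?thesis .
qed

end

section \<open>Ideals\<close>

lemma ideal_gen_base: "g \<in> S \<Longrightarrow> g \<in> ideal_gen n S"
  unfolding ideal_gen_def by (intro CollectI exI[of _ "{g}"] exI[of _ "\<lambda>_. 1"]) simp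

lemma ideal_gen_0: "0 \<in> ideal_gen n S"
  unfolding ideal_gen_def by (intro CollectI exI[of _ "{}"]) simp

lemma ideal_gen_scale: "c \<in> poly_ring n \<Longrightarrow> p \<in> ideal_gen n S \<Longrightarrow> c * p \<in> ideal_gen n S"
  unfolding ideal_gen_def mem_Collect_eq
proof (elim exE conjE)
  fix F d assume "c \<in> poly_ring n" "p = (\<Sum>g\<in>F. d g * g)" "finite F" "F \<subseteq> S" "\<forall>g\<in>F. d g \<in> poly_ring n"
  thus "\<exists>F d. c * p = (\<Sum>g\<in>F. d g * g) \<and> finite F \<and> F \<subseteq> S \<and> (\<forall>g\<in>F. d g \<in> poly_ring n)"
    by (intro exI[of _ F] exI[of _ "\<lambda>g. c * d g"])
       (simp add: sum_distrib_left mult.assoc poly_ring_mult)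
qed

lemma ideal_gen_add:
  fixes p q :: "'a::field mpoly"
  assumes "p \<in> ideal_gen n S" "q \<in> ideal_gen n S"
  shows "p + q \<in> ideal_gen n S"
proof -
  obtain F c where F: "p = (\<Sum>g\<in>F. c g * g)" "finite F" "F \<subseteq> S" "\<forall>g\<in>F. c g \<in> poly_ring n"
    using assms(1) unfolding ideal_gen_def by blast
  obtain G d where G: "q = (\<Sum>g\<in>G. d g * g)" "finite G" "G \<subseteq> S" "\<forall>g\<in>G. d g \<in> poly_ring n"
    using assms(2) unfolding ideal_gen_def by blast
  define e where "e g = (if g \<in> F then c g else 0) + (if g \<in> G then d g else 0)" for g
  have "(\<Sum>g\<in>F \<union> G. e g * g) =
      (\<Sum>g\<in>F \<union> G. if g \<in> F then c g * g else 0) + (\<Sum>g\<in>F \<union> G. if g \<in> G then d g * g else 0)"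
    unfolding sum.distrib[symmetric] by (intro sum.cong) (auto simp: e_def distrib_right)
  also have "(\<Sum>g\<in>F \<union> G. if g \<in> F then c g * g else 0) = p"
    unfolding F(1) by (rule sum.mono_neutral_cong_right) (use F(2) G(2) in auto)
  also have "(\<Sum>g\<in>F \<union> G. if g \<in> G then d g * g else 0) = q"
    unfolding G(1) by (rule sum.mono_neutral_cong_right) (use F(2) G(2) in auto)
  finally have "p + q = (\<Sum>g\<in>F \<union> G. e g * g)" ..
  moreover have "\<forall>g\<in>F \<union> G. e g \<in> poly_ring n"
    using F(4) G(4) by (auto simp: e_def intro: poly_ring_add)
  ultimately show ?thesis
    unfolding ideal_gen_def using F(2,3) G(2,3)
    by (intro CollectI exI[of _ "F \<union> G"] exI[of _ e]) auto
qed

text \<open>Serves as an induction principle for ideals; \<open>T\<close> is often a set of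
  multipliers such as \<open>{b. s * b \<in> ?R}\<close>.\<close>

lemma ideal_gen_least:
  assumes "p \<in> ideal_gen n S" "0 \<in> T" "\<And>p q. p \<in> T \<Longrightarrow> q \<in> T \<Longrightarrow> p + q \<in> T"
    and "\<And>c g. c \<in> poly_ring n \<Longrightarrow> g \<in> T \<Longrightarrow> c * g \<in> T" "S \<subseteq> T"
  shows "p \<in> T"
proof -
  obtain F c where F: "p = (\<Sum>g\<in>F. c g * g)" "finite F" "F \<subseteq> S" "\<forall>g\<in>F. c g \<in> poly_ring n"
    using assms(1) unfolding ideal_gen_def by blast
  from F(2-4) have "(\<Sum>g\<in>F. c g * g) \<in> T"
    by (induction F rule: finite_induct) (use assms(2-) in auto)
  thus ?thesis by (simp add: F(1))
qed

text \<open>Bilinearity in two rounds: for a fixed generator \<open>s\<close> the second factor is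
  varied, then for a fixed second factor the first.\<close>

lemma ideal_mult_ideal_gen:
  fixes S T :: "'a::field mpoly set"
  shows "ideal_mult n (ideal_gen n S) (ideal_gen n T) = ideal_gen n {s * t | s t. s \<in> S \<and> t \<in> T}"
    (is "?L = ?R")
proof
  have "a * b \<in> ?R" if a: "a \<in> ideal_gen n S" and b: "b \<in> ideal_gen n T" for a b
  proof -
    have "b \<in> {b. s * b \<in> ?R}" if "s \<in> S" for s
    proof (rule ideal_gen_least[OF b])
      show "T \<subseteq> {b. s * b \<in> ?R}" using that by (auto intro!: ideal_gen_base)
    qed (auto simp: ideal_gen_0 distrib_left mult.left_commute[of s]
          intro: ideal_gen_add ideal_gen_scale)
    hence "S \<subseteq> {a. a * b \<in> ?R}" by blast
    hence "a \<in> {a. a * b \<in> ?R}"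
      by (intro ideal_gen_least[OF a])
         (auto simp: ideal_gen_0 distrib_right mult.assoc intro: ideal_gen_add ideal_gen_scale)
    thus ?thesis by simp
  qed
  thus "?L \<subseteq> ?R"
    unfolding ideal_mult_def
    by (auto elim!: ideal_gen_least simp: ideal_gen_0 intro: ideal_gen_add ideal_gen_scale)
  have "{s * t | s t. s \<in> S \<and> t \<in> T} \<subseteq> ?L"
    unfolding ideal_mult_def by (auto intro!: ideal_gen_base)
  thus "?R \<subseteq> ?L"
    unfolding ideal_mult_def
    by (auto elim!: ideal_gen_least simp: ideal_gen_0 intro: ideal_gen_add ideal_gen_scale)
qed

lemma poly_ring_eq_ideal_gen: "(poly_ring n :: 'a::field mpoly set) = ideal_gen n {1}"
  (is "?L = ?R")
proof
  show "?L \<subseteq> ?R"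
  proof
    fix p :: "'a mpoly" assume "p \<in> poly_ring n"
    thus "p \<in> ideal_gen n {1}"
      using ideal_gen_scale[of p n 1 "{1}"] ideal_gen_base[of 1 "{1}" n] by simp
  qed
  show "?R \<subseteq> ?L"
    by (auto elim!: ideal_gen_least intro: poly_ring_add poly_ring_mult)
qed

text \<open>Moves from coefficients attached to generators to coefficients attached to their
  indices, as the augmentation needs; injectivity ensures that no generator is counted
  twice.\<close>

lemma ideal_gen_image:
  fixes f :: "'b \<Rightarrow> 'a::field mpoly"
  assumes "finite B" "inj_on f B"
  shows "p \<in> ideal_gen n (f ` B) \<longleftrightarrow> (\<exists>c. (\<forall>b\<in>B. c b \<in> poly_ring n) \<and> p = (\<Sum>b\<in>B. f b * c b))"
proof
  assume "p \<in> ideal_gen n (f ` B)"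
  then obtain F c where F: "p = (\<Sum>g\<in>F. c g * g)" "F \<subseteq> f ` B" "\<forall>g\<in>F. c g \<in> poly_ring n"
    unfolding ideal_gen_def by blast
  have "p = (\<Sum>g\<in>f ` B. if g \<in> F then c g * g else 0)"
    unfolding F(1) by (rule sum.mono_neutral_cong_left) (use F(2) assms(1) in auto)
  also have "\<dots> = (\<Sum>b\<in>B. f b * (if f b \<in> F then c (f b) else 0))"
    unfolding sum.reindex[OF assms(2)] by (intro sum.cong) auto
  finally show "\<exists>c. (\<forall>b\<in>B. c b \<in> poly_ring n) \<and> p = (\<Sum>b\<in>B. f b * c b)"
    using F(3) by (intro exI[of _ "\<lambda>b. if f b \<in> F then c (f b) else 0"]) auto
next
  assume "\<exists>c. (\<forall>b\<in>B. c b \<in> poly_ring n) \<and> p = (\<Sum>b\<in>B. f b * c b)"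
  then obtain c where c: "\<forall>b\<in>B. c b \<in> poly_ring n" "p = (\<Sum>b\<in>B. f b * c b)" by blast
  have "(\<Sum>b\<in>A. f b * c b) \<in> ideal_gen n (f ` B)" if "finite A" "A \<subseteq> B" for A
    using that
  proof (induction A rule: finite_induct)
    case (insert b A)
    hence "c b * f b \<in> ideal_gen n (f ` B)"
      using c(1) by (intro ideal_gen_scale ideal_gen_base) auto
    thus ?case using insert by (simp add: ideal_gen_add mult.commute)
  qed (simp add: ideal_gen_0)
  thus "p \<in> ideal_gen n (f ` B)" using c(2) assms(1) by blast
qed

section \<open>The cubical complex as a resolution by matrices\<close>

context exponent_box
begin

lemma augment_cells:
  assumes "box B"
  shows "augment B z = (\<Sum>c\<in>cells B 0. monom (gexp (fst c)) * z c)"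
proof -
  have "cells B 0 = (\<lambda>b. (b, {})) ` B"
    by (auto simp: cells_def dest: finite_subset[OF _ finite_keys])
  moreover have inj: "inj_on (\<lambda>b. (b, {})) B" by (rule inj_onI) simp
  ultimately show ?thesis by (simp only: augment_def sum.reindex[OF inj] o_def fst_conv)
qed

text \<open>The cells of each dimension are enumerated, and exactness is transported from functions
  on cells to coordinate vectors. All generators have degree \<open>k * card N\<close>, and cubes
  have dimension at most \<open>card N\<close>.\<close>

lemma linear_resolution_of_box:
  assumes B: "box B"
  shows "has_linear_resolution n (ideal_gen n ((\<lambda>b. monom (gexp b)) ` B) :: 'a::field mpoly set)"
proof -
  have fin: "finite B" using B by (simp add: box_def)
  define r where "r i = card (cells B i)" for i
  have "\<exists>e. bij_betw e {..<r i} (cells B i)" for i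
    using ex_bij_betw_nat_finite[OF finite_cells[OF B]] by (simp add: r_def atLeast0LessThan)
  then obtain e where e: "\<And>i. bij_betw (e i) {..<r i} (cells B i)" by metis
  have e_cell: "e i j \<in> cells B i" if "j < r i" for i j
    using e that by (auto simp: bij_betw_def)
  \<comment> \<open>Coordinates of a chain in the chosen enumeration; the value 0 from
    \<open>r i\<close> on is what \<open>free_elem\<close> demands.\<close>
  define pack where "pack i z = (\<lambda>j. if j < r i then z (e i j) else 0)"
    for i and z :: "cell \<Rightarrow> 'a mpoly"
  define g :: "nat \<Rightarrow> 'a mpoly" where "g j = monom (gexp (fst (e 0 j)))" for j
  define M :: "nat \<Rightarrow> nat \<Rightarrow> nat \<Rightarrow> 'a mpoly" where "M i a b = bd_coeff (e (i - 1) a) (e i b)" for i a b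
  have pack_free: "free_elem n (r i) (pack i z)" if "chain B i z" for i z
    using that by (auto simp: free_elem_def pack_def chain_def simp del: split_paired_All)
  have unpack: "\<exists>z. chain B i z \<and> u = pack i z" if u: "free_elem n (r i) u" for i u
  proof -
    define z where "z c = (if c \<in> cells B i then u (inv_into {..<r i} (e i) c) else 0)" for c
    have "inv_into {..<r i} (e i) c < r i" if "c \<in> cells B i" for c
      using inv_into_into[of c "e i" "{..<r i}"] e[of i] that by (simp add: bij_betw_def)
    hence "chain B i z"
      using u unfolding chain_def z_def free_elem_def by simp
    moreover have "u j = pack i z j" for j
      using u e_cell[of j i] bij_betw_inv_into_left[OF e[of i], of j]
      by (auto simp: pack_def z_def free_elem_def)
    ultimately show ?thesis by blast
  qed
  have free_iff: "free_elem n (r i) u \<longleftrightarrow> (\<exists>z. chain B i z \<and> u = pack i z)" for i u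
    using pack_free unpack by blast
  have pack_inj: "y = z" if "chain B i y" "chain B i z" "pack i y = pack i z" for i y z
  proof
    fix c
    show "y c = z c"
    proof (cases "c \<in> cells B i")
      case True
      then obtain j where "j < r i" "c = e i j" using e[of i] by (auto simp: bij_betw_def)
      thus ?thesis using fun_cong[OF that(3), of j] by (simp add: pack_def)
    next
      case False
      thus ?thesis using that(1,2) unfolding chain_def by metis
    qed
  qed
  have pack_0: "pack i (\<lambda>_. 0) = (\<lambda>_. 0)" for i by (simp add: pack_def fun_eq_iff)
  have chain_0: "chain B i (\<lambda>_. 0)" for i by (simp add: chain_def)
  have aug: "(\<Sum>j<r 0. g j * pack 0 z j) = augment B z" for z
  proof -
    have "(\<Sum>j<r 0. g j * pack 0 z j) = (\<Sum>j<r 0. monom (gexp (fst (e 0 j))) * z (e 0 j))"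
      by (intro sum.cong) (simp_all add: g_def pack_def)
    also have "\<dots> = augment B z"
      unfolding augment_cells[OF B]
      using sum.reindex_bij_betw[OF e[of 0], of "\<lambda>c. monom (gexp (fst c)) * z c"] by simp
    finally show ?thesis .
  qed
  have app: "mat_app (M (Suc i)) (r i) (r (Suc i)) (pack (Suc i) z) = pack i (bd z)"
    if "chain B (Suc i) z" for i z
  proof
    fix a
    have "(\<Sum>j<r (Suc i). M (Suc i) a j * pack (Suc i) z j)
        = (\<Sum>j<r (Suc i). bd_coeff (e i a) (e (Suc i) j) * z (e (Suc i) j))"
      by (intro sum.cong) (simp_all add: M_def pack_def)
    also have "\<dots> = bd z (e i a)"
      unfolding bd_expand[OF B that]
      using sum.reindex_bij_betw[OF e[of "Suc i"], of "\<lambda>c. bd_coeff (e i a) c * z c"] by simp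
    finally show "mat_app (M (Suc i)) (r i) (r (Suc i)) (pack (Suc i) z) a = pack i (bd z) a"
      by (simp add: mat_app_def pack_def)
  qed
  \<comment> \<open>Being a column combination of the matrix is the same as being a boundary,
    because \<open>pack\<close> is injective on chains and intertwines \<open>bd\<close> with the
    matrix.\<close>
  have image: "(\<exists>w. free_elem n (r (Suc i)) w \<and> pack i z = mat_app (M (Suc i)) (r i) (r (Suc i)) w)
      \<longleftrightarrow> (\<exists>w. chain B (Suc i) w \<and> bd w = z)" if z: "chain B i z" for i z
  proof -
    have "pack i z = pack i (bd w) \<longleftrightarrow> bd w = z" if "chain B (Suc i) w" for w
      using pack_inj[OF chain_bd[OF B that] z] by metis
    thus ?thesis unfolding free_iff using app by metis
  qed
  have "ideal_gen n ((\<lambda>b. monom (gexp b)) ` B) = {(\<Sum>j<r 0. g j * u j) | u. free_elem n (r 0) u}"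
    (is "?I = ?J")
  proof (rule set_eqI)
    fix p
    have inj: "inj_on (\<lambda>b. monom (gexp b) :: 'a mpoly) B"
      using B gexp_inj by (auto simp: inj_on_def box_def)
    have "p \<in> ?J \<longleftrightarrow> (\<exists>z. chain B 0 z \<and> p = (\<Sum>j<r 0. g j * pack 0 z j))"
      unfolding free_iff by blast
    also have "\<dots> \<longleftrightarrow> (\<exists>z. chain B 0 z \<and> p = augment B z)"
      unfolding aug ..
    also have "\<dots> \<longleftrightarrow> (\<exists>c. (\<forall>b\<in>B. c b \<in> poly_ring n) \<and> p = (\<Sum>b\<in>B. monom (gexp b) * c b))"
    proof (intro iffI; elim exE conjE)
      fix z assume "chain B 0 z" "p = augment B z"
      thus "\<exists>c. (\<forall>b\<in>B. c b \<in> poly_ring n) \<and> p = (\<Sum>b\<in>B. monom (gexp b) * c b)"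
        by (intro exI[of _ "\<lambda>b. z (b, {})"]) (auto simp: augment_def chain_def simp del: split_paired_All)
    next
      fix c assume c: "\<forall>b\<in>B. c b \<in> poly_ring n" "p = (\<Sum>b\<in>B. monom (gexp b) * c b)"
      let ?z = "\<lambda>(b, A). if b \<in> B \<and> A = {} then c b else 0"
      have "chain B 0 ?z" using c(1) by (auto simp: chain_def cells_def)
      moreover have "p = augment B ?z" using c(2) by (simp add: augment_def)
      ultimately show "\<exists>z. chain B 0 z \<and> p = augment B z" by blast
    qed
    also have "\<dots> \<longleftrightarrow> p \<in> ?I" using ideal_gen_image[OF fin inj] by blast
    finally show "p \<in> ?I \<longleftrightarrow> p \<in> ?J" ..
  qed
  moreover have "\<forall>i>card N. r i = 0"
  proof (intro allI impI)
    fix i assume i: "card N < i"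
    have "(b, A) \<notin> cells B i" for b A
    proof
      assume "(b, A) \<in> cells B i"
      hence A: "b \<in> B" "A \<subseteq> keys b" "card A = i" by (auto simp: cells_def)
      have "A \<subseteq> N" using A(1,2) B unfolding box_def by blast
      hence "card A \<le> card N" by (intro card_mono finite_N)
      thus False using i A(3) by simp
    qed
    hence "cells B i = {}" by auto
    thus "r i = 0" by (simp add: r_def)
  qed
  moreover have "\<forall>j<r 0. g j \<in> poly_ring n \<and> homogeneous (k * card N) (g j)"
  proof (intro allI impI)
    fix j assume "j < r 0"
    hence "fst (e 0 j) \<in> B" using e_cell[of j 0] by (auto simp: cells_def)
    thus "g j \<in> poly_ring n \<and> homogeneous (k * card N) (g j)"
      using B poly_ring_monom[OF keys_gexp]
      by (auto simp: g_def homogeneous_def box_def mdeg_gexp)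
  qed
  moreover have "\<forall>i\<ge>1. \<forall>a<r (i - 1). \<forall>b<r i. M i a b \<in> poly_ring n \<and> homogeneous 1 (M i a b)"
    unfolding M_def using bd_coeff_poly_ring bd_coeff_homogeneous by blast
  moreover have "\<forall>u. free_elem n (r 0) u \<longrightarrow> ((\<Sum>j<r 0. g j * u j) = 0 \<longleftrightarrow>
      (\<exists>w. free_elem n (r 1) w \<and> u = mat_app (M 1) (r 0) (r 1) w))"
  proof (intro allI impI)
    fix u :: "nat \<Rightarrow> 'a mpoly" assume "free_elem n (r 0) u"
    then obtain z where z: "chain B 0 z" "u = pack 0 z" using unpack by blast
    show "(\<Sum>j<r 0. g j * u j) = 0 \<longleftrightarrow> (\<exists>w. free_elem n (r 1) w \<and> u = mat_app (M 1) (r 0) (r 1) w)"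
      unfolding z(2) aug using image[OF z(1)] exactness_iff[OF B z(1)] by simp
  qed
  moreover have "\<forall>i\<ge>1. \<forall>u. free_elem n (r i) u \<longrightarrow> (mat_app (M i) (r (i - 1)) (r i) u = (\<lambda>_. 0) \<longleftrightarrow>
      (\<exists>w. free_elem n (r (Suc i)) w \<and> u = mat_app (M (Suc i)) (r i) (r (Suc i)) w))"
  proof (intro allI impI)
    fix i :: nat and u :: "nat \<Rightarrow> 'a mpoly" assume "1 \<le> i" "free_elem n (r i) u"
    then obtain j z where i: "i = Suc j" and z: "chain B i z" "u = pack i z"
      using unpack by (metis One_nat_def Suc_le_D)
    have "pack j (bd z) = (\<lambda>_. 0) \<longleftrightarrow> bd z = (\<lambda>_. 0)"
      using pack_inj[OF chain_bd[OF B] chain_0, of j z] z(1) pack_0[of j] unfolding i by metis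
    thus "mat_app (M i) (r (i - 1)) (r i) u = (\<lambda>_. 0) \<longleftrightarrow>
      (\<exists>w. free_elem n (r (Suc i)) w \<and> u = mat_app (M (Suc i)) (r i) (r (Suc i)) w)"
      unfolding z(2) image[OF z(1)] using app[of j z] exactness_iff[OF B z(1)] z(1) i by simp
  qed
  ultimately show ?thesis
    unfolding has_linear_resolution_def by blast
qed

end

section \<open>Vertex covers of graphs with a clique partition\<close>

context exponent_box
begin

lemma lookup_gexp_outside: "t \<notin> N \<Longrightarrow> lookup (gexp b) t = (\<Sum>w\<in>N. if v w = t then lookup b w else 0)"
  unfolding gexp_def lookup_sum by (intro sum.cong) (auto simp: lookup_add lookup_single when_def)

end

text \<open>Lets products of generators be computed by adding exponents while the bounds add up too;
  the assumed bounds exclude truncation in each factor.\<close>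

lemma gexp_add:
  assumes "exponent_box n N v" "\<And>w. lookup b w \<le> k" "\<And>w. lookup c w \<le> j"
  shows "exponent_box.gexp k N v b + exponent_box.gexp j N v c = exponent_box.gexp (k + j) N v (b + c)"
  unfolding exponent_box.gexp_def[OF assms(1)] sum.distrib[symmetric]
proof (intro sum.cong refl)
  fix w
  have x: "single w (k - lookup b w) + single w (j - lookup c w) = single w (k + j - lookup (b + c) w)"
    using assms(2,3)[of w] by (simp add: single_add[symmetric] lookup_add)
  have y: "single (v w) (lookup b w) + single (v w) (lookup c w) = single (v w) (lookup (b + c) w)"
    by (simp add: single_add lookup_add)
  show "single w (k - lookup b w) + single (v w) (lookup b w) +
      (single w (j - lookup c w) + single (v w) (lookup c w)) =
      single w (k + j - lookup (b + c) w) + single (v w) (lookup (b + c) w)"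
    using arg_cong2[of _ _ _ _ "(+)", OF x y] by (simp only: ac_simps)
qed

text \<open>The fibres of \<open>v\<close> are cliques partitioning the vertices, and \<open>v w\<close> is a vertex
  of the fibre of \<open>w\<close> without neighbours outside that fibre.\<close>

locale clique_partition =
  fixes n :: nat and E :: "nat \<Rightarrow> nat \<Rightarrow> bool" and v :: "nat \<Rightarrow> nat"
  assumes graph: "simple_graph_on n E"
    and v_in: "w \<in> {1..n} \<Longrightarrow> v w \<in> {1..n}"
    and v_v: "w \<in> {1..n} \<Longrightarrow> v (v w) = v w"
    and fibre_clique: "w \<in> {1..n} \<Longrightarrow> u \<in> {1..n} \<Longrightarrow> v w = v u \<Longrightarrow> w \<noteq> u \<Longrightarrow> E w u"
    and centre_neighbour: "w \<in> {1..n} \<Longrightarrow> E (v w) u \<Longrightarrow> v u = v w"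
begin

definition N :: "nat set" where
  "N = {w \<in> {1..n}. v w \<noteq> w}"

sublocale B: exponent_box n k N v for k
proof
  show "N \<subseteq> {1..n}" by (auto simp: N_def)
  show "v ` N \<subseteq> {1..n} - N" using v_in v_v by (auto simp: N_def)
qed

lemma edge_sym: "E i j \<Longrightarrow> E j i"
  using graph by (simp add: simple_graph_on_def)

lemma edge_irrefl: "\<not> E i i"
  using graph by (simp add: simple_graph_on_def)

lemma edge_in: "E i j \<Longrightarrow> i \<in> {1..n} \<and> j \<in> {1..n}"
  using graph unfolding simple_graph_on_def by blast

text \<open>Two distinct missed vertices of one fibre would span an uncovered edge.\<close>

lemma cover_misses_one:
  assumes "is_vertex_cover n E C" "w \<in> {1..n}" "u \<in> {1..n}" "w \<notin> C" "u \<notin> C" "v w = v u"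
  shows "w = u"
  using assms fibre_clique[of w u] unfolding is_vertex_cover_def by blast

lemma min_cover_iff:
  "is_min_vertex_cover n E C \<longleftrightarrow>
    is_vertex_cover n E C \<and> (\<forall>w\<in>{1..n}. \<exists>u\<in>{1..n}. v u = v w \<and> u \<notin> C)" (is "?L \<longleftrightarrow> ?R")
proof
  assume L: ?L
  hence cover: "is_vertex_cover n E C" by (simp add: is_min_vertex_cover_def)
  have "\<exists>u\<in>{1..n}. v u = v w \<and> u \<notin> C" if w: "w \<in> {1..n}" for w
  proof (rule ccontr)
    assume "\<not> ?thesis"
    hence all: "u \<in> C" if "u \<in> {1..n}" "v u = v w" for u using that by blast
    have centre: "j \<in> C - {v w}" if "E (v w) j" for j
      using all[of j] centre_neighbour[OF w that] edge_in[OF that] edge_irrefl[of j] that by auto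
    have "i \<in> C - {v w} \<or> j \<in> C - {v w}" if "E i j" for i j
      using centre[of i] centre[of j] that edge_sym[OF that] cover
      unfolding is_vertex_cover_def by blast
    hence "is_vertex_cover n E (C - {v w})"
      using cover unfolding is_vertex_cover_def by blast
    moreover have "C - {v w} \<subset> C" using all[of "v w"] v_in[OF w] v_v[OF w] by blast
    ultimately show False using L by (auto simp: is_min_vertex_cover_def)
  qed
  thus ?R using cover by blast
next
  assume R: ?R
  have "\<not> is_vertex_cover n E D" if "D \<subset> C" for D
  proof
    assume D: "is_vertex_cover n E D"
    obtain x where x: "x \<in> C" "x \<notin> D" using \<open>D \<subset> C\<close> by blast
    hence "x \<in> {1..n}" using R unfolding is_vertex_cover_def by blast
    then obtain u where u: "u \<in> {1..n}" "v u = v x" "u \<notin> C" using R by blast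
    thus False
      using cover_misses_one[OF D \<open>x \<in> {1..n}\<close> u(1)] x \<open>D \<subset> C\<close> by auto
  qed
  thus ?L using R by (simp add: is_min_vertex_cover_def)
qed

text \<open>The exponent on \<open>N\<close> that encodes a minimal cover. Missed centres are left
  out: a centre is missed exactly when no other vertex of its fibre is.\<close>

definition missing :: "nat set \<Rightarrow> (nat \<Rightarrow>\<^sub>0 nat)" where
  "missing C = (\<Sum>w\<in>N - C. single w 1)"

lemma lookup_missing: "lookup (missing C) w = (if w \<in> N - C then 1 else 0)"
  by (simp add: missing_def lookup_sum lookup_single when_def sum.delta')

text \<open>At a centre \<open>t\<close> the exponent counts the missed vertices of \<open>N\<close>
  in its fibre. Exactly one vertex of the fibre is missed, so the count is 1 if \<open>t\<close> is
  in the cover and 0 if \<open>t\<close> is itself the missed one.\<close>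

lemma gexp_missing:
  assumes "is_min_vertex_cover n E C"
  shows "B.gexp 1 (missing C) = (\<Sum>i\<in>C. single i 1)"
proof (rule poly_mapping_eqI)
  fix t
  have cover: "is_vertex_cover n E C" using assms by (simp add: is_min_vertex_cover_def)
  hence C: "C \<subseteq> {1..n}" "finite C"
    using finite_subset by (auto simp: is_vertex_cover_def)
  have rhs: "lookup (\<Sum>i\<in>C. single i 1) t = (if t \<in> C then 1 else (0::nat))"
    using C(2) by (simp add: lookup_sum lookup_single when_def sum.delta')
  show "lookup (B.gexp 1 (missing C)) t = lookup (\<Sum>i\<in>C. single i 1) t"
  proof (cases "t \<in> N")
    case True
    thus ?thesis using rhs by (simp add: B.lookup_gexp lookup_missing)
  next
    case False
    have lhs: "lookup (B.gexp 1 (missing C)) t = (\<Sum>w\<in>N. if v w = t \<and> w \<notin> C then 1 else 0)"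
      unfolding B.lookup_gexp_outside[OF False] by (intro sum.cong) (simp_all add: lookup_missing)
    show ?thesis
    proof (cases "t \<in> C")
      case True
      hence t: "t \<in> {1..n}" "v t = t" using C False by (auto simp: N_def)
      obtain u where u: "u \<in> {1..n}" "v u = t" "u \<notin> C"
        using assms t unfolding min_cover_iff by metis
      have "u \<in> N" using u True by (auto simp: N_def)
      have "v w = t \<and> w \<notin> C \<longleftrightarrow> w = u" if "w \<in> N" for w
        using cover_misses_one[OF cover, of w u] u that by (auto simp: N_def)
      hence "(\<Sum>w\<in>N. if v w = t \<and> w \<notin> C then 1 else 0) = (\<Sum>w\<in>N. if w = u then 1 else (0::nat))"
        by (intro sum.cong) auto
      also have "\<dots> = 1" using \<open>u \<in> N\<close> by simp
      finally show ?thesis using lhs rhs True by simp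
    next
      case False
      have "w \<in> C" if "w \<in> N" "v w = t" for w
      proof (rule ccontr)
        assume "w \<notin> C"
        moreover have "w \<in> {1..n}" "v w \<noteq> w" using \<open>w \<in> N\<close> by (auto simp: N_def)
        ultimately show False
          using cover_misses_one[OF cover, of w "v w"] v_in v_v False \<open>v w = t\<close> by metis
      qed
      hence "(\<Sum>w\<in>N. if v w = t \<and> w \<notin> C then 1 else 0) = (0::nat)"
        by (intro sum.neutral) auto
      thus ?thesis using lhs rhs False by simp
    qed
  qed
qed

text \<open>The new cover contains \<open>t\<close> and misses \<open>v t\<close> instead. Edges at
  \<open>v t\<close> stay covered because their other ends lie in the fibre, where \<open>t\<close>
  was the only vertex missed.\<close>

lemma exchange:
  assumes "is_min_vertex_cover n E C" "t \<in> N" "t \<notin> C"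
  obtains C' where "is_min_vertex_cover n E C'" "missing C = missing C' + single t 1"
proof
  let ?C = "insert t (C - {v t})"
  have cover: "is_vertex_cover n E C" using assms(1) by (simp add: is_min_vertex_cover_def)
  have t: "t \<in> {1..n}" "v t \<noteq> t" using assms(2) by (auto simp: N_def)
  have centre: "j \<in> ?C" if "E (v t) j" for j
  proof (rule ccontr)
    assume j: "j \<notin> ?C"
    have "j \<noteq> v t" using edge_irrefl that by blast
    hence "j \<notin> C" "j \<noteq> t" using j by auto
    moreover have "v j = v t" "j \<in> {1..n}" using centre_neighbour[OF t(1) that] edge_in[OF that] by auto
    ultimately show False using cover_misses_one[OF cover t(1), of j] assms(3) by auto
  qed
  have "i \<in> ?C \<or> j \<in> ?C" if "E i j" for i j
    using centre[of i] centre[of j] that edge_sym[OF that] cover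
    unfolding is_vertex_cover_def by blast
  hence "is_vertex_cover n E ?C"
    using cover t unfolding is_vertex_cover_def by blast
  moreover have "\<exists>u\<in>{1..n}. v u = v w \<and> u \<notin> ?C" if w: "w \<in> {1..n}" for w
  proof (cases "v w = v t")
    case True
    thus ?thesis using v_in[OF t(1)] v_v[OF t(1)] t(2) by (intro bexI[of _ "v t"]) auto
  next
    case False
    obtain u where "u \<in> {1..n}" "v u = v w" "u \<notin> C" using assms(1) w unfolding min_cover_iff by blast
    thus ?thesis using False by (intro bexI[of _ u]) auto
  qed
  ultimately show "is_min_vertex_cover n E ?C" unfolding min_cover_iff by blast
  have "v t \<notin> N" using v_v[OF t(1)] by (simp add: N_def)
  thus "missing C = missing ?C + single t 1"
    using assms(2,3) by (intro poly_mapping_eqI) (auto simp: lookup_add lookup_missing lookup_single when_def)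
qed

fun missing_sums :: "nat \<Rightarrow> (nat \<Rightarrow>\<^sub>0 nat) set" where
  "missing_sums 0 = {0}"
| "missing_sums (Suc k) = {missing C + b | C b. is_min_vertex_cover n E C \<and> b \<in> missing_sums k}"

lemma keys_missing: "keys (missing C) \<subseteq> N"
  by (auto simp: in_keys_iff lookup_missing split: if_splits)

lemma missing_sums_bounds: "b \<in> missing_sums k \<Longrightarrow> keys b \<subseteq> N \<and> (\<forall>w. lookup b w \<le> k)"
proof (induction k arbitrary: b)
  case (Suc k)
  then obtain C b' where b: "b = missing C + b'" "b' \<in> missing_sums k" by auto
  show ?case
  proof (intro conjI allI)
    show "keys b \<subseteq> N" using Suc.IH[OF b(2)] keys_missing by (simp add: b(1) keys_add_nat)
    fix w
    have "lookup b' w \<le> k" using Suc.IH[OF b(2)] by blast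
    moreover have "lookup (missing C) w \<le> 1" by (simp add: lookup_missing)
    ultimately show "lookup b w \<le> Suc k" unfolding b(1) lookup_add by linarith
  qed
qed simp

lemma finite_missing_sums: "finite (missing_sums k)"
proof (induction k)
  case (Suc k)
  have "finite {C. is_min_vertex_cover n E C}"
    by (rule finite_subset[of _ "Pow {1..n}"]) (auto simp: is_min_vertex_cover_def is_vertex_cover_def)
  hence "finite ((\<lambda>(C, b). missing C + b) ` ({C. is_min_vertex_cover n E C} \<times> missing_sums k))"
    using Suc by simp
  moreover have "missing_sums (Suc k) = (\<lambda>(C, b). missing C + b) ` ({C. is_min_vertex_cover n E C} \<times> missing_sums k)"
    by auto
  ultimately show ?case by simp
qed simp

text \<open>The unit to be removed at \<open>t\<close> comes either from the first cover, which then
  misses \<open>t\<close> and can be exchanged, or from the remaining sum, to which the induction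
  hypothesis applies.\<close>

lemma missing_sums_down:
  "b + single t 1 \<in> missing_sums k \<Longrightarrow> t \<in> N \<Longrightarrow> b \<in> missing_sums k"
proof (induction k arbitrary: b)
  case 0
  hence "lookup (b + single t 1) t = 0" by simp
  thus ?case by (simp add: lookup_add)
next
  case (Suc k)
  then obtain C b' where b: "b + single t 1 = missing C + b'" "is_min_vertex_cover n E C" "b' \<in> missing_sums k"
    by auto
  show ?case
  proof (cases "t \<in> C")
    case False
    then obtain C' where C': "is_min_vertex_cover n E C'" "missing C = missing C' + single t 1"
      using exchange[OF b(2) Suc.prems(2)] by blast
    have "b + single t 1 = (missing C' + b') + single t 1"
      using b(1) unfolding C'(2) by (simp add: ac_simps)
    hence "b = missing C' + b'" by (rule add_right_imp_eq)
    thus ?thesis using C'(1) b(3) by auto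
  next
    case True
    define c where "c = b' - single t 1"
    \<comment> \<open>Here \<open>missing C\<close> vanishes at \<open>t\<close>, so
      \<open>b'\<close> is positive there and the subtraction defining \<open>c\<close> is
      exact.\<close>
    have "lookup b t + 1 = lookup b' t"
      using arg_cong[OF b(1), of "\<lambda>p. lookup p t"] True by (simp add: lookup_add lookup_missing)
    hence b': "b' = c + single t 1"
      unfolding c_def by (intro poly_mapping_eqI)
        (auto simp: lookup_add lookup_minus lookup_single when_def)
    hence "c \<in> missing_sums k" using Suc.IH[of c] b(3) Suc.prems(2) by simp
    moreover have "b + single t 1 = (missing C + c) + single t 1"
      using b(1) unfolding b' by (simp add: ac_simps)
    hence "b = missing C + c" by (rule add_right_imp_eq)
    ultimately show ?thesis using b(2) by auto
  qed
qed

lemma box_missing_sums: "B.box k (missing_sums k)"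
  unfolding B.box_def down_closed_def
  using finite_missing_sums missing_sums_bounds missing_sums_down by blast

text \<open>Induction on \<open>k\<close> from the unit ideal: multiplying by the generator of a
  cover \<open>C\<close> adds \<open>missing C\<close> to the exponent.\<close>

lemma ideal_pow_vertex_cover_ideal:
  "ideal_pow n (vertex_cover_ideal n E :: 'a::field mpoly set) k =
    ideal_gen n ((\<lambda>b. monom (B.gexp k b)) ` missing_sums k)"
proof (induction k)
  case 0
  have "B.gexp 0 0 = 0" by (simp add: B.gexp_def)
  thus ?case by (simp add: poly_ring_eq_ideal_gen monom_def)
next
  case (Suc k)
  have gen: "sqfree_monomial C = (monom (B.gexp 1 (missing C)) :: 'a mpoly)" if "is_min_vertex_cover n E C" for C
    unfolding gexp_missing[OF that] sqfree_monomial_def monom_def ..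
  have prod: "sqfree_monomial C * monom (B.gexp k b) = (monom (B.gexp (Suc k) (missing C + b)) :: 'a mpoly)"
    if "is_min_vertex_cover n E C" "b \<in> missing_sums k" for C b
    unfolding gen[OF that(1)] monom_mult using missing_sums_bounds[OF that(2)]
    by (subst gexp_add[OF B.exponent_box_axioms]) (auto simp: lookup_missing)
  have "{s * t | s t. s \<in> {sqfree_monomial C | C. is_min_vertex_cover n E C} \<and>
        t \<in> (\<lambda>b. monom (B.gexp k b)) ` missing_sums k} =
      (\<lambda>b. monom (B.gexp (Suc k) b) :: 'a mpoly) ` missing_sums (Suc k)" (is "?L = ?R")
  proof
    show "?L \<subseteq> ?R"
    proof clarify
      fix C b assume "is_min_vertex_cover n E C" "b \<in> missing_sums k"
      thus "(sqfree_monomial C * monom (B.gexp k b) :: 'a mpoly) \<in> ?R"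
        using prod by auto
    qed
    show "?R \<subseteq> ?L"
    proof clarify
      fix b assume "b \<in> missing_sums (Suc k)"
      then obtain C b' where "b = missing C + b'" "is_min_vertex_cover n E C" "b' \<in> missing_sums k" by auto
      thus "\<exists>s t. monom (B.gexp (Suc k) b) = (s * t :: 'a mpoly) \<and>
          s \<in> {sqfree_monomial C | C. is_min_vertex_cover n E C} \<and>
          t \<in> (\<lambda>b. monom (B.gexp k b)) ` missing_sums k"
        using prod[of C b'] by (intro exI[of _ "sqfree_monomial C"] exI[of _ "monom (B.gexp k b')"]) auto
    qed
  qed
  thus ?case
    unfolding ideal_pow.simps Suc.IH
    unfolding vertex_cover_ideal_def ideal_mult_ideal_gen by (rule arg_cong)
qed

lemma linear_resolution_ideal_pow:
  "has_linear_resolution n (ideal_pow n (vertex_cover_ideal n E :: 'a::field mpoly set) k)"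
  unfolding ideal_pow_vertex_cover_ideal
  by (rule B.linear_resolution_of_box[OF box_missing_sums])

end

section \<open>From disjoint facets with free vertices to a clique partition\<close>

lemma clique_in_facet:
  assumes "is_clique n E C"
  obtains F where "is_facet n E F" "C \<subseteq> F"
proof -
  let ?S = "{D. is_clique n E D \<and> C \<subseteq> D}"
  have fin: "finite ?S"
    by (rule finite_subset[of _ "Pow {1..n}"]) (auto simp: is_clique_def)
  have "C \<in> ?S" using assms by simp
  from finite_has_maximal2[OF fin this]
  obtain F where F: "F \<in> ?S" "\<forall>D\<in>?S. F \<subseteq> D \<longrightarrow> F = D" by (elim bexE conjE)
  hence "is_facet n E F" unfolding is_facet_def by auto
  thus ?thesis using that F(1) by simp
qed

text \<open>Each vertex \<open>w\<close> lies in a unique facet \<open>fac w\<close> of the family,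
  and is sent to a chosen free vertex of it. The fibres are these facets, as disjointness lets the
  centre determine its facet.\<close>

lemma clique_partition_of_free_facets:
  assumes graph: "simple_graph_on n E"
    and cover: "\<Union> (facets_with_free_vertex n E) = {1..n}"
    and disjoint: "\<forall>F\<in>facets_with_free_vertex n E. \<forall>F'\<in>facets_with_free_vertex n E.
            F \<noteq> F' \<longrightarrow> F \<inter> F' = {}"
  shows "\<exists>v. clique_partition n E v"
proof -
  let ?\<F> = "facets_with_free_vertex n E"
  have "\<forall>w\<in>{1..n}. \<exists>F. F \<in> ?\<F> \<and> w \<in> F" using cover by blast
  then obtain fac where fac: "\<And>w. w \<in> {1..n} \<Longrightarrow> fac w \<in> ?\<F> \<and> w \<in> fac w" by metis
  have fac_eq: "fac w = F" if "F \<in> ?\<F>" "w \<in> F" for w F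
  proof -
    have "w \<in> {1..n}" using that cover by blast
    thus ?thesis using fac that disjoint by blast
  qed
  have "\<forall>F\<in>?\<F>. \<exists>x. free_vertex n E F x" by (simp add: facets_with_free_vertex_def)
  then obtain fv where fv: "\<And>F. F \<in> ?\<F> \<Longrightarrow> free_vertex n E F (fv F)" by metis
  have fv_in: "fv F \<in> F" if "F \<in> ?\<F>" for F using fv[OF that] by (simp add: free_vertex_def)
  have fac_fv: "fac (fv (fac w)) = fac w" if "w \<in> {1..n}" for w
    using fac_eq[of "fac w" "fv (fac w)"] fac[OF that] fv_in by blast
  have "clique_partition n E (\<lambda>w. fv (fac w))"
  proof
    show "simple_graph_on n E" by fact
    fix w assume w: "w \<in> {1..n}"
    show "fv (fac w) \<in> {1..n}" using fac[OF w] fv_in cover by blast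
    show "fv (fac (fv (fac w))) = fv (fac w)" by (simp add: fac_fv[OF w])
    show "E w u" if u: "u \<in> {1..n}" "fv (fac w) = fv (fac u)" "w \<noteq> u" for u
    proof -
      have "fac w = fac u" using fac_fv[OF w] fac_fv[OF u(1)] u(2) by metis
      hence "w \<in> fac w" "u \<in> fac w" "is_clique n E (fac w)"
        using fac[OF w] fac[OF u(1)] by (auto simp: facets_with_free_vertex_def is_facet_def)
      thus ?thesis using u(3) by (simp add: is_clique_def)
    qed
    show "fv (fac u) = fv (fac w)" if "E (fv (fac w)) u" for u
    proof -
      \<comment> \<open>An edge at a free vertex extends to a facet, and freeness leaves only
        \<open>fac w\<close>; so the neighbour lies there too.\<close>
      have "is_clique n E {fv (fac w), u}"
        using graph that by (auto simp: is_clique_def simple_graph_on_def)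
      then obtain F where F: "is_facet n E F" "fv (fac w) \<in> F" "u \<in> F"
        using clique_in_facet by (metis insert_subset)
      have "F = fac w" using fv[of "fac w"] fac[OF w] F(1,2) by (simp add: free_vertex_def)
      thus ?thesis using fac_eq[of F u] F(3) fac[OF w] by simp
    qed
  qed
  thus ?thesis by (rule exI[of "clique_partition n E"])
qed

theorem theorem2p7:
  fixes n :: nat and E :: "nat \<Rightarrow> nat \<Rightarrow> bool"
  assumes "simple_graph_on n E"
    and "\<Union> (facets_with_free_vertex n E) = {1..n}"
    and "\<forall>F\<in>facets_with_free_vertex n E. \<forall>F'\<in>facets_with_free_vertex n E.
            F \<noteq> F' \<longrightarrow> F \<inter> F' = {}"
    and "k \<ge> 1"
  shows "has_linear_resolution n (ideal_pow n (vertex_cover_ideal n E :: 'a::field mpoly set) k)"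
  using clique_partition_of_free_facets[OF assms(1-3)] clique_partition.linear_resolution_ideal_pow by blast

end
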